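(* Let $G$ be a discrete group, $K$ a $G$-equivariant discrete monoid with unit, and $A^{*,*}=A^{*,*}(K\rtimes G,\mathbb T)$. Consider the homomorphism $$\phi:H^3(\mathrm{Tot}(A^{*,*}))\to MS_G(K),\qquad[\alpha\oplus\beta\oplus\theta]\mapsto[\alpha\oplus\beta].$$ Its kernel satisfies $$\ker\big(H^3(\mathrm{Tot}(A^{*,*}))\xrightarrow{\phi}MS_G(K)\big)\cong\iota\big(H^3(C^*(K,\mathbb T)^G)\big),$$ and its cokernel satisfies $$\mathrm{coker}\big(H^3(\mathrm{Tot}(A^{*,*}))\xrightarrow{\phi}MS_G(K)\big)\cong\ker\big(H^4(C^*(K,\mathbb T)^G)\to H^4(\mathrm{Tot}(A^{*,*}))\big).$$
   Context: $\mathbb T=S^1$, written multiplicatively. $C^{p,q}(K\rtimes G,\mathbb T)$ is the group of maps $F:G^p\times K^q\to\mathbb T$, values $F[g_1|\dots|g_p||k_1|\dots|k_q]$, equal to $1$ if some $g_i$ or $k_j$ is the identity, with differentials $(\delta_GF)[g_1|\dots|g_{p+1}||k_1|\dots|k_q]=F[g_2|\dots|g_{p+1}||k_1|\dots|k_q]\prod_{i=1}^pF[\dots|g_ig_{i+1}|\dots||k_1|\dots|k_q]^{(-1)^i}F[g_1|\dots|g_p||g_{p+1}(k_1)|\dots|g_{p+1}(k_q)]^{(-1)^{p+1}}$ and $(\delta_KF)[g_1|\dots|g_p||k_1|\dots|k_{q+1}]=F[\dots||k_2|\dots|k_{q+1}]\prod_{j=1}^qF[\dots||\dots|k_jk_{j+1}|\dots]^{(-1)^j}F[\dots||k_1|\dots|k_q]^{(-1)^{q+1}}$.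 $A^{*,*}$ consists of the $C^{p,q}$ with $q>0$, and $A^{*,*>r}$ of those with $q>r$; total complexes carry the differential $\delta_G\oplus\delta_K^{(-1)^p}$. $MS_G(K)=\{[\alpha\oplus\beta]\in H^3(\mathrm{Tot}(A^{*,*}/A^{*,*>2})): [\delta_K\beta]=1\}$, with $\alpha\in C^{2,1}$, $\beta\in C^{1,2}$, where $[\delta_K\beta]=1$ means $\delta_K\beta=\delta_G\theta$ for some $\theta\in C^{0,3}$. $C^*(K,\mathbb T)^G$ is the complex of $G$-invariant normalized cochains $K^q\to\mathbb T$ with differential $\delta_K$, i.e. the cochains in $C^{0,q}$ closed under $\delta_G$. The maps $\iota:H^3(C^*(K,\mathbb T)^G)\to H^3(\mathrm{Tot}(A^{*,*}))$ and $H^4(C^*(K,\mathbb T)^G)\to H^4(\mathrm{Tot}(A^{*,*}))$ are induced by the inclusion of invariant cochains into $A^{0,*}\subset\mathrm{Tot}(A^{*,*})$. *)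

theory Defs
  imports Complex_Main "HOL-Algebra.Bij" "HOL-Algebra.Product_Groups"
begin

section \<open>Cochain complexes and double complexes of abelian groups\<close>

text \<open>The records carry only the data; that the differentials are homomorphisms with
  \<open>d d = 1\<close> is not part of the types.\<close>

record 'a cplx =
  Ob :: "nat \<Rightarrow> 'a monoid"
  df :: "nat \<Rightarrow> 'a \<Rightarrow> 'a"

record 'a dcplx =
  DOb :: "nat \<Rightarrow> nat \<Rightarrow> 'a monoid"
  dh :: "nat \<Rightarrow> nat \<Rightarrow> 'a \<Rightarrow> 'a"  \<comment> \<open>bidegree \<open>(p, q)\<close> to \<open>(p + 1, q)\<close>\<close>
  dv :: "nat \<Rightarrow> nat \<Rightarrow> 'a \<Rightarrow> 'a"  \<comment> \<open>bidegree \<open>(p, q)\<close> to \<open>(p, q + 1)\<close>\<close>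

text \<open>The map between quotients by a subgroup of the source and the subgroup \<open>N\<close> of \<open>H\<close> that
  is induced by \<open>f\<close>. If \<open>f\<close> respects the subgroups then all cosets in this union coincide.\<close>

definition coset_map ::
    "('b, 'c) monoid_scheme \<Rightarrow> 'b set \<Rightarrow> ('a \<Rightarrow> 'b) \<Rightarrow> 'a set \<Rightarrow> 'b set" where
  "coset_map H N f X = (\<Union>x\<in>X. N #>\<^bsub>H\<^esub> f x)"

definition cocycles :: "'a cplx \<Rightarrow> nat \<Rightarrow> 'a set" where
  "cocycles E n = kernel (Ob E n) (Ob E (Suc n)) (df E n)"

definition coboundaries :: "'a cplx \<Rightarrow> nat \<Rightarrow> 'a set" where
  "coboundaries E n =
     (case n of 0 \<Rightarrow> {\<one>\<^bsub>Ob E 0\<^esub>} | Suc m \<Rightarrow> df E m ` carrier (Ob E m))"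

definition cohomology :: "'a cplx \<Rightarrow> nat \<Rightarrow> 'a set monoid" where
  "cohomology E n = (Ob E n)\<lparr>carrier := cocycles E n\<rparr> Mod coboundaries E n"

definition coh_class :: "'a cplx \<Rightarrow> nat \<Rightarrow> 'a \<Rightarrow> 'a set" where
  "coh_class E n x = coboundaries E n #>\<^bsub>Ob E n\<^esub> x"

definition coh_map :: "'b cplx \<Rightarrow> nat \<Rightarrow> ('a \<Rightarrow> 'b) \<Rightarrow> 'a set \<Rightarrow> 'b set" where
  "coh_map E n f = coset_map (Ob E n) (coboundaries E n) f"

definition quot_dcplx :: "'a dcplx \<Rightarrow> 'a dcplx \<Rightarrow> 'a set dcplx" where
  "quot_dcplx D S =
     \<lparr>DOb = (\<lambda>p q. DOb D p q Mod carrier (DOb S p q)),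
      dh = (\<lambda>p q. coset_map (DOb D (Suc p) q) (carrier (DOb S (Suc p) q)) (dh D p q)),
      dv = (\<lambda>p q. coset_map (DOb D p (Suc q)) (carrier (DOb S p (Suc q))) (dv D p q))\<rparr>"

text \<open>An element \<open>x\<close> of total degree \<open>n\<close> is indexed by the vertical degree: \<open>x q\<close> has
  bidegree \<open>(n - q, q)\<close>. The component of its differential in bidegree \<open>(n + 1 - q, q)\<close>
  is, written additively, the sum of the horizontal differential of \<open>x q\<close> and \<open>(-1)\<^sup>p\<close> times the vertical one of
  \<open>x (q - 1)\<close>, where \<open>p = n + 1 - q\<close> is the horizontal degree of \<open>x (q - 1)\<close>.\<close>

definition Tot :: "'a dcplx \<Rightarrow> (nat \<Rightarrow> 'a) cplx" where
  "Tot D =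
     \<lparr>Ob = (\<lambda>n. product_group {..n} (\<lambda>q. DOb D (n - q) q)),
      df = (\<lambda>n x. \<lambda>q\<in>{..Suc n}.
        (if q \<le> n then dh D (n - q) q (x q) else \<one>\<^bsub>DOb D (Suc n - q) q\<^esub>)
        \<otimes>\<^bsub>DOb D (Suc n - q) q\<^esub>
        (if 0 < q
         then dv D (Suc n - q) (q - 1) (x (q - 1)) [^]\<^bsub>DOb D (Suc n - q) q\<^esub> ((-1 :: int) ^ (Suc n - q))
         else \<one>\<^bsub>DOb D (Suc n - q) q\<^esub>))\<rparr>"

definition Tot_proj :: "'a dcplx \<Rightarrow> 'a dcplx \<Rightarrow> nat \<Rightarrow> (nat \<Rightarrow> 'a) \<Rightarrow> nat \<Rightarrow> 'a set" where
  "Tot_proj D S n x =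
     (\<lambda>q\<in>{..n}. carrier (DOb S (n - q) q) #>\<^bsub>DOb D (n - q) q\<^esub> x q)"


section \<open>Circle-valued cochains of a monoid with group action\<close>

text \<open>\<open>tuples M n\<close> is the set \<open>M\<^sup>n\<close>; entry \<open>i\<close> (counted from 1) of a tuple \<open>xs\<close> is \<open>xs ! (i - 1)\<close>.\<close>

definition tuples :: "('a, 'b) monoid_scheme \<Rightarrow> nat \<Rightarrow> 'a list set" where
  "tuples M n = {xs. length xs = n \<and> set xs \<subseteq> carrier M}"

text \<open>\<open>[x\<^sub>1|\<dots>|x\<^sub>i x\<^sub>i\<^sub>+\<^sub>1|\<dots>|x\<^sub>n]\<close>\<close>

definition merge :: "('a, 'b) monoid_scheme \<Rightarrow> nat \<Rightarrow> 'a list \<Rightarrow> 'a list" where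
  "merge M i xs = take (i - 1) xs @ (xs ! (i - 1) \<otimes>\<^bsub>M\<^esub> xs ! i) # drop (i + 1) xs"

type_synonym ('g, 'k) cochain = "'g list \<Rightarrow> 'k list \<Rightarrow> complex"

text \<open>Normalized cochains \<open>G\<^sup>p \<times> K\<^sup>q \<rightarrow> S\<^sup>1\<close>. They are functions on all lists; the second
  condition fixes the irrelevant values outside \<open>G\<^sup>p \<times> K\<^sup>q\<close> to be 1.\<close>

definition cochains ::
    "('g, 'a) monoid_scheme \<Rightarrow> ('k, 'b) monoid_scheme \<Rightarrow> nat \<Rightarrow> nat \<Rightarrow> ('g, 'k) cochain monoid" where
  "cochains G K p q =
     \<lparr>carrier = {F.
        (\<forall>gs\<in>tuples G p. \<forall>ks\<in>tuples K q. cmod (F gs ks) = 1) \<and>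
        (\<forall>gs ks. \<not> (gs \<in> tuples G p \<and> ks \<in> tuples K q) \<longrightarrow> F gs ks = 1) \<and>
        (\<forall>gs ks. \<one>\<^bsub>G\<^esub> \<in> set gs \<or> \<one>\<^bsub>K\<^esub> \<in> set ks \<longrightarrow> F gs ks = 1)},
      mult = (\<lambda>F F' gs ks. F gs ks * F' gs ks),
      one = (\<lambda>gs ks. 1)\<rparr>"

definition delta_G ::
    "('g, 'a) monoid_scheme \<Rightarrow> ('k, 'b) monoid_scheme \<Rightarrow> ('g \<Rightarrow> 'k \<Rightarrow> 'k) \<Rightarrow>
     nat \<Rightarrow> nat \<Rightarrow> ('g, 'k) cochain \<Rightarrow> ('g, 'k) cochain" where
  "delta_G G K act p q F = (\<lambda>gs ks.
     if gs \<in> tuples G (Suc p) \<and> ks \<in> tuples K q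
     then F (tl gs) ks
          * (\<Prod>i = 1..p. F (merge G i gs) ks powi ((-1) ^ i))
          * F (butlast gs) (map (act (last gs)) ks) powi ((-1) ^ (p + 1))
     else 1)"

definition delta_K ::
    "('g, 'a) monoid_scheme \<Rightarrow> ('k, 'b) monoid_scheme \<Rightarrow>
     nat \<Rightarrow> nat \<Rightarrow> ('g, 'k) cochain \<Rightarrow> ('g, 'k) cochain" where
  "delta_K G K p q F = (\<lambda>gs ks.
     if gs \<in> tuples G p \<and> ks \<in> tuples K (Suc q)
     then F gs (tl ks)
          * (\<Prod>j = 1..q. F gs (merge K j ks) powi ((-1) ^ j))
          * F gs (butlast ks) powi ((-1) ^ (q + 1))
     else 1)"

text \<open>The double complex \<open>A\<^sup>*\<^sup>,\<^sup>*\<^sup>>\<^sup>r\<close>, which is trivial in bidegrees \<open>(p, q)\<close> with \<open>q \<le> r\<close>;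
  the complex \<open>A\<^sup>*\<^sup>,\<^sup>*\<close> itself is the case \<open>r = 0\<close>.\<close>

definition A_gt ::
    "('g, 'a) monoid_scheme \<Rightarrow> ('k, 'b) monoid_scheme \<Rightarrow> ('g \<Rightarrow> 'k \<Rightarrow> 'k) \<Rightarrow>
     nat \<Rightarrow> ('g, 'k) cochain dcplx" where
  "A_gt G K act r =
     \<lparr>DOb = (\<lambda>p q. if r < q then cochains G K p q
                   else (cochains G K p q)\<lparr>carrier := {\<one>\<^bsub>cochains G K p q\<^esub>}\<rparr>),
      dh = delta_G G K act,
      dv = delta_K G K\<rparr>"

abbreviation A where "A G K act \<equiv> A_gt G K act 0"

abbreviation A_mod where "A_mod G K act \<equiv> quot_dcplx (A G K act) (A_gt G K act 2)"

text \<open>\<open>\<alpha> \<oplus> \<beta> \<oplus> \<theta>\<close> in \<open>C\<^sup>2\<^sup>,\<^sup>1 \<oplus> C\<^sup>1\<^sup>,\<^sup>2 \<oplus> C\<^sup>0\<^sup>,\<^sup>3\<close>, the degree 3 part of \<open>Tot A\<close>, and the element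
  \<open>\<alpha> \<oplus> \<beta>\<close> of the degree 3 part of \<open>Tot (A / A\<^sup>*\<^sup>,\<^sup>*\<^sup>>\<^sup>2)\<close>.\<close>

definition triple ::
    "('g, 'k) cochain \<Rightarrow> ('g, 'k) cochain \<Rightarrow> ('g, 'k) cochain \<Rightarrow> nat \<Rightarrow> ('g, 'k) cochain" where
  "triple \<alpha> \<beta> \<theta> =
     (\<lambda>q\<in>{..3}. if q = 1 then \<alpha> else if q = 2 then \<beta> else if q = 3 then \<theta> else (\<lambda>gs ks. 1))"

definition pair ::
    "('g, 'a) monoid_scheme \<Rightarrow> ('k, 'b) monoid_scheme \<Rightarrow> ('g \<Rightarrow> 'k \<Rightarrow> 'k) \<Rightarrow>
     ('g, 'k) cochain \<Rightarrow> ('g, 'k) cochain \<Rightarrow> nat \<Rightarrow> ('g, 'k) cochain set" where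
  "pair G K act \<alpha> \<beta> =
     Tot_proj (A G K act) (A_gt G K act 2) 3 (triple \<alpha> \<beta> (\<lambda>gs ks. 1))"

definition MS ::
    "('g, 'a) monoid_scheme \<Rightarrow> ('k, 'b) monoid_scheme \<Rightarrow> ('g \<Rightarrow> 'k \<Rightarrow> 'k) \<Rightarrow>
     (nat \<Rightarrow> ('g, 'k) cochain set) set monoid" where
  "MS G K act = (cohomology (Tot (A_mod G K act)) 3)
     \<lparr>carrier := {coh_class (Tot (A_mod G K act)) 3 (pair G K act \<alpha> \<beta>) | \<alpha> \<beta>.
        \<alpha> \<in> carrier (cochains G K 2 1) \<and> \<beta> \<in> carrier (cochains G K 1 2) \<and>
        pair G K act \<alpha> \<beta> \<in> cocycles (Tot (A_mod G K act)) 3 \<and>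
        (\<exists>\<theta>\<in>carrier (cochains G K 0 3). delta_K G K 1 2 \<beta> = delta_G G K act 0 3 \<theta>)}\<rparr>"

definition phi ::
    "('g, 'a) monoid_scheme \<Rightarrow> ('k, 'b) monoid_scheme \<Rightarrow> ('g \<Rightarrow> 'k \<Rightarrow> 'k) \<Rightarrow>
     (nat \<Rightarrow> ('g, 'k) cochain) set \<Rightarrow> (nat \<Rightarrow> ('g, 'k) cochain set) set" where
  "phi G K act =
     coh_map (Tot (A_mod G K act)) 3 (Tot_proj (A G K act) (A_gt G K act 2) 3)"

definition inv_cplx ::
    "('g, 'a) monoid_scheme \<Rightarrow> ('k, 'b) monoid_scheme \<Rightarrow> ('g \<Rightarrow> 'k \<Rightarrow> 'k) \<Rightarrow>
     ('g, 'k) cochain cplx" where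
  "inv_cplx G K act =
     \<lparr>Ob = (\<lambda>q. (cochains G K 0 q)\<lparr>carrier :=
        {F \<in> carrier (cochains G K 0 q).
           \<forall>g\<in>carrier G. \<forall>ks\<in>tuples K q. F [] (map (act g) ks) = F [] ks}\<rparr>),
      df = delta_K G K 0\<rparr>"

definition incl :: "nat \<Rightarrow> ('g, 'k) cochain \<Rightarrow> nat \<Rightarrow> ('g, 'k) cochain" where
  "incl n F = (\<lambda>q\<in>{..n}. if q = n then F else (\<lambda>gs ks. 1))"

text \<open>The map induced by inclusion from the degree \<open>n\<close> cohomology of the invariant cochains to
  that of \<open>Tot A\<close>.\<close>

definition iota ::
    "('g, 'a) monoid_scheme \<Rightarrow> ('k, 'b) monoid_scheme \<Rightarrow> ('g \<Rightarrow> 'k \<Rightarrow> 'k) \<Rightarrow> nat \<Rightarrow>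
     ('g, 'k) cochain set \<Rightarrow> (nat \<Rightarrow> ('g, 'k) cochain) set" where
  "iota G K act n = coh_map (Tot (A G K act)) n (incl n)"

end

theory Submission
  imports Defs
begin

text \<open>Let \<open>\<pi>\<close> be the projection from \<open>Tot A\<close> onto \<open>Tot (A / A\<^sup>*\<^sup>,\<^sup>*\<^sup>>\<^sup>2)\<close>, and let \<open>Z\<close> be the group of
  those \<open>x\<close> of degree 3 in \<open>Tot A\<close> whose differential \<open>d x\<close> is an invariant cochain in \<open>C\<^sup>0\<^sup>,\<^sup>4\<close>. For
  \<open>x = \<alpha> \<oplus> \<beta> \<oplus> \<theta>\<close> this says that \<open>\<alpha> \<oplus> \<beta>\<close> is a cocycle and \<open>\<delta>\<^sub>K \<beta> = \<delta>\<^sub>G \<theta>\<close>; the invariance of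
  \<open>d x = \<delta>\<^sub>K \<theta>\<close> is then automatic. Hence \<open>x \<mapsto> [\<pi> x]\<close> maps \<open>Z\<close> onto \<open>MS\<close>, and \<open>x \<mapsto> [d x]\<close> maps \<open>Z\<close> onto
  the kernel of the map from \<open>H\<^sup>4\<close> of the invariant cochains to \<open>H\<^sup>4 (Tot A)\<close>. An \<open>x \<in> Z\<close> with
  \<open>\<pi> x = 1\<close> lies in \<open>C\<^sup>0\<^sup>,\<^sup>3\<close> and is itself invariant. Therefore \<open>[d x] = 1\<close> holds iff \<open>[\<pi> x]\<close>
  lies in the image of \<open>\<phi>\<close>, so that both sides of the cokernel statement are the quotient of \<open>Z\<close> by
  one and the same subgroup; the kernel statement follows from the same observation.\<close>

section \<open>Cohomology of cochain complexes\<close>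

lemma (in comm_group) comm_group_subgroup:
  assumes "subgroup H G" shows "comm_group (G\<lparr>carrier := H\<rparr>)"
  by (rule group.group_comm_groupI[OF subgroup.subgroup_is_group[OF assms is_group]])
    (use subgroup.subset[OF assms] m_comm in auto)

text \<open>The first isomorphism theorem, applied to both maps: \<open>X\<close> and
  \<open>Y\<close> are quotients of \<open>Z\<close> by one kernel. It yields the cokernel
  isomorphism without a map being written down between the two sides.\<close>

lemma iso_of_kernel_eq:
  assumes "group_hom Z X u" "group_hom Z Y v"
    and "u ` carrier Z = carrier X" "v ` carrier Z = carrier Y"
    and "kernel Z X u = kernel Z Y v"
  shows "X \<cong> Y"
proof -
  have "Z Mod kernel Z X u \<cong> X" "Z Mod kernel Z X u \<cong> Y"
    using group_hom.FactGroup_iso assms by metis+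
  moreover have "group (Z Mod kernel Z X u)"
    using assms(1) by (simp add: group_hom.normal_kernel normal.factorgroup_is_group)
  ultimately show ?thesis
    by (meson group.iso_sym iso_trans)
qed

text \<open>The laws that the record \<open>cplx\<close> leaves out. Commutativity makes the
  coboundaries normal, so that the cohomology is a group.\<close>

locale cochain_complex =
  fixes E :: "'a cplx"
  assumes comm_group_Ob: "comm_group (Ob E n)"
    and df_hom: "df E n \<in> hom (Ob E n) (Ob E (Suc n))"
    and df_df: "x \<in> carrier (Ob E n) \<Longrightarrow> df E (Suc n) (df E n x) = \<one>\<^bsub>Ob E (Suc (Suc n))\<^esub>"
begin

lemma group_Ob: "group (Ob E n)"
  using comm_group_Ob comm_group.axioms(2) by blast

lemma group_hom_df: "group_hom (Ob E n) (Ob E (Suc n)) (df E n)"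
  by (simp add: df_hom group_Ob group_hom.intro group_hom_axioms.intro)

lemma subgroup_cocycles: "subgroup (cocycles E n) (Ob E n)"
  unfolding cocycles_def by (rule group_hom.subgroup_kernel[OF group_hom_df])

lemma subgroup_coboundaries: "subgroup (coboundaries E n) (Ob E n)"
  unfolding coboundaries_def
  by (cases n) (auto simp: group.triv_subgroup[OF group_Ob] group_hom.img_is_subgroup[OF group_hom_df])

lemma coboundaries_subset_cocycles: "coboundaries E n \<subseteq> cocycles E n"
proof (cases n)
  case 0
  then show ?thesis
    using subgroup.one_closed[OF subgroup_cocycles, of 0] by (simp add: coboundaries_def)
next
  case (Suc m)
  then show ?thesis
    using df_df df_hom[of m] by (auto simp: coboundaries_def cocycles_def kernel_def hom_def)
qed

lemma cocycles_carrier: "x \<in> cocycles E n \<Longrightarrow> x \<in> carrier (Ob E n)"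
  by (simp add: cocycles_def kernel_def)

lemma comm_group_cocycles: "comm_group ((Ob E n)\<lparr>carrier := cocycles E n\<rparr>)"
  by (simp add: comm_group_Ob comm_group.comm_group_subgroup subgroup_cocycles)

lemma subgroup_coboundaries_cocycles:
  "subgroup (coboundaries E n) ((Ob E n)\<lparr>carrier := cocycles E n\<rparr>)"
  by (simp add: coboundaries_subset_cocycles group.subgroup_incl group_Ob subgroup_coboundaries
      subgroup_cocycles)

lemma comm_group_cohomology: "comm_group (cohomology E n)"
  unfolding cohomology_def
  by (rule comm_group.abelian_FactGroup[OF comm_group_cocycles subgroup_coboundaries_cocycles])

lemma group_cohomology: "group (cohomology E n)"
  using comm_group_cohomology comm_group.axioms(2) by blast

lemma carrier_cohomology: "carrier (cohomology E n) = coh_class E n ` cocycles E n"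
  by (simp add: cohomology_def carrier_FactGroup coh_class_def cong: image_cong)

lemma coh_class_hom: "coh_class E n \<in> hom ((Ob E n)\<lparr>carrier := cocycles E n\<rparr>) (cohomology E n)"
proof -
  interpret normal "coboundaries E n" "(Ob E n)\<lparr>carrier := cocycles E n\<rparr>"
    using comm_group_cocycles subgroup_coboundaries_cocycles
    by (simp add: comm_group.normal_iff_subgroup)
  \<comment> \<open>\<open>coh_class\<close> forms its coset in \<open>Ob E n\<close>, and
    \<open>cohomology\<close> in the subgroup of cocycles; the multiplication is shared, so the
    cosets are the same sets.\<close>
  show ?thesis
    using r_coset_hom_Mod by (simp add: cohomology_def coh_class_def[abs_def])
qed

lemma coh_class_eq_iff:
  assumes "x \<in> cocycles E n" "y \<in> cocycles E n"
  shows "coh_class E n x = coh_class E n y \<longleftrightarrow> (\<exists>b\<in>coboundaries E n. y = b \<otimes>\<^bsub>Ob E n\<^esub> x)"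
proof
  assume "coh_class E n x = coh_class E n y"
  then have "y \<in> coboundaries E n #>\<^bsub>Ob E n\<^esub> x"
    using group.rcos_self[OF group_Ob cocycles_carrier[OF assms(2)] subgroup_coboundaries]
    by (simp add: coh_class_def)
  then show "\<exists>b\<in>coboundaries E n. y = b \<otimes>\<^bsub>Ob E n\<^esub> x"
    by (auto simp: r_coset_def)
next
  assume "\<exists>b\<in>coboundaries E n. y = b \<otimes>\<^bsub>Ob E n\<^esub> x"
  then have "y \<in> coboundaries E n #>\<^bsub>Ob E n\<^esub> x"
    by (auto simp: r_coset_def)
  then show "coh_class E n x = coh_class E n y"
    unfolding coh_class_def
    by (rule group.repr_independence[OF group_Ob _ cocycles_carrier[OF assms(1)] subgroup_coboundaries])
qed

lemma coh_class_eq_one_iff: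
  assumes "x \<in> cocycles E n"
  shows "coh_class E n x = \<one>\<^bsub>cohomology E n\<^esub> \<longleftrightarrow> x \<in> coboundaries E n"
proof -
  have "\<one>\<^bsub>cohomology E n\<^esub> = coh_class E n \<one>\<^bsub>Ob E n\<^esub>"
    using hom_one[OF coh_class_hom] comm_group_cocycles[of n] group_cohomology[of n]
    by (simp add: comm_group.axioms(2))
  moreover have "\<one>\<^bsub>Ob E n\<^esub> \<in> cocycles E n"
    by (rule subgroup.one_closed[OF subgroup_cocycles])
  ultimately show ?thesis
    using coh_class_eq_iff[of "\<one>\<^bsub>Ob E n\<^esub>" n x] assms subgroup.subset[OF subgroup_coboundaries, of n]
      group.is_monoid[OF group_Ob, of n] monoid.r_one by fastforce
qed

end

text \<open>Another representative differs from \<open>x\<close> by a factor \<open>b\<close> in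
  \<open>M\<close>, and its image by the factor \<open>f b\<close> in \<open>N\<close>. All cosets
  in the union therefore coincide.\<close>

lemma coset_map_r_coset:
  assumes "group G" "group H" "f \<in> hom G H" "subgroup M G" "subgroup N H" "f ` M \<subseteq> N"
    and x: "x \<in> carrier G"
  shows "coset_map H N f (M #>\<^bsub>G\<^esub> x) = N #>\<^bsub>H\<^esub> f x"
proof -
  have "N #>\<^bsub>H\<^esub> f y = N #>\<^bsub>H\<^esub> f x" if y: "y \<in> M #>\<^bsub>G\<^esub> x" for y
  proof -
    obtain b where b: "b \<in> M" "y = b \<otimes>\<^bsub>G\<^esub> x"
      using y by (auto simp: r_coset_def)
    have "f y = f b \<otimes>\<^bsub>H\<^esub> f x"
      using b subgroup.subset[OF assms(4)] x assms(3) by (auto simp: hom_def)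
    then have "f y \<in> N #>\<^bsub>H\<^esub> f x"
      using b(1) assms(6) by (auto simp: r_coset_def)
    then show ?thesis
      using group.repr_independence[OF assms(2) _ _ assms(5)] assms(3) x
      by (metis hom_in_carrier)
  qed
  moreover have "x \<in> M #>\<^bsub>G\<^esub> x"
    using assms(1,4) x by (simp add: group.rcos_self)
  ultimately show ?thesis
    unfolding coset_map_def by blast
qed

text \<open>The hypotheses on \<open>f\<close> concern degree \<open>n\<close> alone, so that the
  result covers the inclusion of invariant cochains, which does not map into \<open>Tot A\<close> in
  degree 0.\<close>

lemma coh_map_coh_class:
  assumes "cochain_complex E" "cochain_complex F"
    and "f \<in> hom (Ob E n) (Ob F n)" "f ` coboundaries E n \<subseteq> coboundaries F n"
    and "x \<in> carrier (Ob E n)"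
  shows "coh_map F n f (coh_class E n x) = coh_class F n (f x)"
  unfolding coh_map_def coh_class_def using assms
  by (intro coset_map_r_coset) (auto simp: cochain_complex.group_Ob cochain_complex.subgroup_coboundaries)

section \<open>Kernel and cokernel in an abstract setting\<close>

text \<open>In the application \<open>D\<close>, \<open>Q\<close> and \<open>B\<close> are \<open>Tot A\<close>, its quotient \<open>Tot (A / A\<^sup>*\<^sup>,\<^sup>*\<^sup>>\<^sup>r)\<close> and the complex of
  invariant cochains, with \<open>m = r\<close>. In degree 0 the map \<open>j\<close> does not take values in \<open>D\<close>, since
  \<open>A\<^sup>0\<^sup>,\<^sup>0\<close> is trivial and the group of invariant cochains is not.\<close>

locale cokernel_setting =
  D: cochain_complex D + Q: cochain_complex Q + B: cochain_complex B
  for D :: "'d cplx" and Q :: "'q cplx" and B :: "'b cplx" +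
  fixes \<pi> :: "nat \<Rightarrow> 'd \<Rightarrow> 'q" and j :: "nat \<Rightarrow> 'b \<Rightarrow> 'd" and m :: nat
  assumes m_pos: "0 < m"
    and proj_hom: "\<pi> k \<in> hom (Ob D k) (Ob Q k)"
    and proj_surj: "\<pi> k ` carrier (Ob D k) = carrier (Ob Q k)"
    and proj_df: "x \<in> carrier (Ob D k) \<Longrightarrow> \<pi> (Suc k) (df D k x) = df Q k (\<pi> k x)"
    and incl_hom: "0 < k \<Longrightarrow> j k \<in> hom (Ob B k) (Ob D k)"
    and incl_inj: "0 < k \<Longrightarrow> inj_on (j k) (carrier (Ob B k))"
    and incl_df: "0 < k \<Longrightarrow> y \<in> carrier (Ob B k) \<Longrightarrow> j (Suc k) (df B k y) = df D k (j k y)"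
    and proj_incl: "m < k \<Longrightarrow> y \<in> carrier (Ob B k) \<Longrightarrow> \<pi> k (j k y) = \<one>\<^bsub>Ob Q k\<^esub>"
    and kernel_proj: "\<lbrakk>x \<in> carrier (Ob D (Suc m)); \<pi> (Suc m) x = \<one>\<^bsub>Ob Q (Suc m)\<^esub>;
        df D (Suc m) x \<in> j (Suc (Suc m)) ` carrier (Ob B (Suc (Suc m)))\<rbrakk>
      \<Longrightarrow> x \<in> j (Suc m) ` carrier (Ob B (Suc m))"
begin

abbreviation n where "n \<equiv> Suc m"

section \<open>The group \<open>Z\<close> and its image \<open>M\<close> in the cohomology of the
  quotient\<close>

definition Z where
  "Z = {x \<in> carrier (Ob D n). df D n x \<in> j (Suc n) ` carrier (Ob B (Suc n))}"

text \<open>The abstract counterpart of \<open>MS\<close>, defined as an image so that the map from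
  \<open>Z\<close> is onto by construction.\<close>

definition M where
  "M = (cohomology Q n)\<lparr>carrier := (\<lambda>x. coh_class Q n (\<pi> n x)) ` Z\<rparr>"

abbreviation \<phi> where "\<phi> \<equiv> coh_map Q n (\<pi> n)"
abbreviation \<iota> where "\<iota> k \<equiv> coh_map D k (j k)"

lemma group_hom_proj: "group_hom (Ob D k) (Ob Q k) (\<pi> k)"
  by (simp add: D.group_Ob Q.group_Ob group_hom.intro group_hom_axioms.intro proj_hom)

lemma group_hom_incl: "0 < k \<Longrightarrow> group_hom (Ob B k) (Ob D k) (j k)"
  by (simp add: D.group_Ob B.group_Ob group_hom.intro group_hom_axioms.intro incl_hom)

lemma proj_closed: "x \<in> carrier (Ob D k) \<Longrightarrow> \<pi> k x \<in> carrier (Ob Q k)"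
  using proj_hom hom_in_carrier by metis

lemma incl_closed: "0 < k \<Longrightarrow> x \<in> carrier (Ob B k) \<Longrightarrow> j k x \<in> carrier (Ob D k)"
  using incl_hom hom_in_carrier by metis

lemma subgroup_Z: "subgroup Z (Ob D n)"
proof -
  interpret d: group_hom "Ob D n" "Ob D (Suc n)" "df D n" by (rule D.group_hom_df)
  interpret j: group_hom "Ob B (Suc n)" "Ob D (Suc n)" "j (Suc n)" by (simp add: group_hom_incl)
  note im = j.img_is_subgroup
  show ?thesis
    unfolding Z_def
    by (rule d.G.subgroupI)
      (auto simp del: image_iff simp: subgroup.m_closed[OF im] subgroup.m_inv_closed[OF im]
        subgroup.one_closed[OF im] intro!: exI[of _ "\<one>\<^bsub>Ob D n\<^esub>"])
qed

lemma cocycles_subset_Z: "cocycles D n \<subseteq> Z"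
proof -
  interpret j: group_hom "Ob B (Suc n)" "Ob D (Suc n)" "j (Suc n)" by (simp add: group_hom_incl)
  show ?thesis
    using subgroup.one_closed[OF j.img_is_subgroup] by (auto simp: Z_def cocycles_def kernel_def)
qed

text \<open>\<open>\<pi>\<close> commutes with the differentials and is trivial on the image of
  \<open>j\<close> in degree \<open>Suc n\<close>, where the differential of \<open>x\<close>
  lies.\<close>

lemma proj_cocycle:
  assumes "x \<in> Z" shows "\<pi> n x \<in> cocycles Q n"
proof -
  obtain y where y: "x \<in> carrier (Ob D n)" "y \<in> carrier (Ob B (Suc n))" "df D n x = j (Suc n) y"
    using assms by (auto simp: Z_def)
  then have "df Q n (\<pi> n x) = \<one>\<^bsub>Ob Q (Suc n)\<^esub>"
    using proj_df[of x n] proj_incl[of "Suc n" y] by simp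
  then show ?thesis
    using y(1) proj_closed by (simp add: cocycles_def kernel_def)
qed

lemma group_Z: "group ((Ob D n)\<lparr>carrier := Z\<rparr>)"
  by (simp add: D.group_Ob subgroup.subgroup_is_group subgroup_Z)

lemma Z_carrier: "x \<in> Z \<Longrightarrow> x \<in> carrier (Ob D n)"
  by (simp add: Z_def)

lemma class_proj_hom:
  "(\<lambda>x. coh_class Q n (\<pi> n x)) \<in> hom ((Ob D n)\<lparr>carrier := Z\<rparr>) (cohomology Q n)"
  using Q.coh_class_hom[of n] proj_hom[of n] proj_cocycle by (auto simp: hom_def Pi_iff Z_carrier)

lemma subgroup_M: "subgroup (carrier M) (cohomology Q n)"
  using group_hom.img_is_subgroup[of "(Ob D n)\<lparr>carrier := Z\<rparr>" "cohomology Q n"]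
    class_proj_hom group_Z Q.group_cohomology
  by (simp add: M_def group_hom_def group_hom_axioms_def)

lemma comm_group_M: "comm_group M"
  using comm_group.comm_group_subgroup[OF Q.comm_group_cohomology subgroup_M] by (simp add: M_def)

lemma group_M: "group M"
  using comm_group_M comm_group.axioms(2) by blast

lemma group_hom_class_proj:
  "group_hom ((Ob D n)\<lparr>carrier := Z\<rparr>) M (\<lambda>x. coh_class Q n (\<pi> n x))"
  using class_proj_hom group_Z group_M
  by (simp add: M_def group_hom_def group_hom_axioms_def hom_def Pi_iff)

section \<open>The maps induced on cohomology\<close>

lemma proj_coboundaries: "\<pi> n ` coboundaries D n \<subseteq> coboundaries Q n"
  using proj_closed by (auto simp: coboundaries_def proj_df)

text \<open>\<open>\<pi>\<close> is onto in degree \<open>m\<close> and commutes with the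
  differentials, so a change of representative in \<open>Q\<close> can be carried out in
  \<open>D\<close>.\<close>

lemma coboundary_lift:
  assumes "b \<in> coboundaries Q n"
  shows "\<exists>y\<in>carrier (Ob D m). b = \<pi> n (df D m y)"
proof -
  obtain q where q: "q \<in> carrier (Ob Q m)" "b = df Q m q"
    using assms by (auto simp: coboundaries_def)
  then obtain y where "y \<in> carrier (Ob D m)" "q = \<pi> m y"
    using proj_surj[of m] by blast
  then show ?thesis
    using q proj_df by auto
qed

lemma phi_coh_class:
  "x \<in> carrier (Ob D n) \<Longrightarrow> \<phi> (coh_class D n x) = coh_class Q n (\<pi> n x)"
  by (rule coh_map_coh_class[OF D.cochain_complex_axioms Q.cochain_complex_axioms proj_hom proj_coboundaries])

text \<open>Since \<open>k\<close> exceeds the positive number \<open>m\<close>, a cochain with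
  coboundary in degree \<open>k\<close> has positive degree, where \<open>j\<close> commutes with
  the differentials.\<close>

lemma incl_coboundaries: "m < k \<Longrightarrow> j k ` coboundaries B k \<subseteq> coboundaries D k"
  using m_pos incl_closed by (cases k) (auto simp: coboundaries_def incl_df intro!: imageI)

lemma iota_coh_class:
  "m < k \<Longrightarrow> y \<in> carrier (Ob B k) \<Longrightarrow> \<iota> k (coh_class B k y) = coh_class D k (j k y)"
  by (rule coh_map_coh_class[OF B.cochain_complex_axioms D.cochain_complex_axioms])
    (auto intro: incl_hom dest: subsetD[OF incl_coboundaries])

text \<open>Cocycles are reflected as well as preserved because \<open>j\<close> is injective in
  degree \<open>Suc k\<close>.\<close>

lemma incl_cocycle: "0 < k \<Longrightarrow> y \<in> carrier (Ob B k) \<Longrightarrow> j k y \<in> cocycles D k \<longleftrightarrow> y \<in> cocycles B k"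
proof -
  assume k: "0 < k" and y: "y \<in> carrier (Ob B k)"
  interpret j: group_hom "Ob B (Suc k)" "Ob D (Suc k)" "j (Suc k)" by (simp add: group_hom_incl)
  have "df B k y \<in> carrier (Ob B (Suc k))"
    using y B.df_hom hom_in_carrier by metis
  then have "j (Suc k) (df B k y) = \<one>\<^bsub>Ob D (Suc k)\<^esub> \<longleftrightarrow> df B k y = \<one>\<^bsub>Ob B (Suc k)\<^esub>"
    using incl_inj[of "Suc k"] by (metis inj_onD j.G.one_closed j.hom_one zero_less_Suc)
  then show ?thesis
    using k y by (simp add: cocycles_def kernel_def incl_df[symmetric] incl_closed)
qed

lemma group_hom_phi: "group_hom (cohomology D n) M \<phi>"
proof -
  have "\<phi> \<in> hom (cohomology D n) M"
  proof (rule homI)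
    fix X assume "X \<in> carrier (cohomology D n)"
    then show "\<phi> X \<in> carrier M"
      using cocycles_subset_Z phi_coh_class by (auto simp: D.carrier_cohomology M_def D.cocycles_carrier)
  next
    fix X Y assume "X \<in> carrier (cohomology D n)" "Y \<in> carrier (cohomology D n)"
    then obtain x y where x: "x \<in> cocycles D n" "X = coh_class D n x"
      and y: "y \<in> cocycles D n" "Y = coh_class D n y"
      by (auto simp: D.carrier_cohomology)
    have xy: "x \<in> Z" "y \<in> Z"
      using x y cocycles_subset_Z by auto
    have "X \<otimes>\<^bsub>cohomology D n\<^esub> Y = coh_class D n (x \<otimes>\<^bsub>Ob D n\<^esub> y)"
      using hom_mult[OF D.coh_class_hom, of x n y] x y by simp
    then show "\<phi> (X \<otimes>\<^bsub>cohomology D n\<^esub> Y) = \<phi> X \<otimes>\<^bsub>M\<^esub> \<phi> Y"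
      using x y xy hom_mult[OF class_proj_hom, of x y] subgroup.m_closed[OF subgroup_Z xy]
      by (simp add: phi_coh_class Z_carrier M_def)
  qed
  then show ?thesis
    by (simp add: D.group_cohomology group_M group_hom.intro group_hom_axioms.intro)
qed

lemma one_M: "\<one>\<^bsub>M\<^esub> = \<one>\<^bsub>cohomology Q n\<^esub>"
  by (simp add: M_def)

text \<open>If the projection of a cocycle bounds, the cocycle differs by a coboundary of
  \<open>D\<close> from one with trivial projection, and \<open>kernel_proj\<close> places the
  latter in the image of \<open>j\<close>. Conversely, \<open>\<pi>\<close> is trivial on that
  image.\<close>

lemma kernel_phi: "kernel (cohomology D n) M \<phi> = \<iota> n ` carrier (cohomology B n)"
proof (intro equalityI subsetI)
  fix X assume "X \<in> kernel (cohomology D n) M \<phi>"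
  then obtain x where x: "x \<in> cocycles D n" "X = coh_class D n x"
    and one: "coh_class Q n (\<pi> n x) = \<one>\<^bsub>cohomology Q n\<^esub>"
    by (auto simp: kernel_def D.carrier_cohomology phi_coh_class one_M D.cocycles_carrier)
  have "\<pi> n x \<in> coboundaries Q n"
    using one Q.coh_class_eq_one_iff proj_cocycle x cocycles_subset_Z by blast
  then obtain y where y: "y \<in> carrier (Ob D m)" "\<pi> n x = \<pi> n (df D m y)"
    using coboundary_lift by blast
  interpret p: group_hom "Ob D n" "Ob Q n" "\<pi> n" by (rule group_hom_proj)
  interpret D: comm_group "Ob D n" by (rule D.comm_group_Ob)
  define b where "b = df D m y"
  have bc: "b \<in> coboundaries D n"
    using y by (simp add: b_def coboundaries_def)
  have b: "b \<in> cocycles D n"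
    using bc D.coboundaries_subset_cocycles by blast
  \<comment> \<open>\<open>z\<close> represents the same class as \<open>x\<close>, and dividing by
    \<open>b\<close> makes its projection trivial.\<close>
  define z where "z = inv\<^bsub>Ob D n\<^esub> b \<otimes>\<^bsub>Ob D n\<^esub> x"
  have zc: "z \<in> cocycles D n"
    unfolding z_def using b x D.subgroup_cocycles by (simp add: subgroup.m_closed subgroup.m_inv_closed)
  have bx: "b \<in> carrier (Ob D n)" "x \<in> carrier (Ob D n)"
    using b x by (simp_all add: D.cocycles_carrier)
  have "\<pi> n z = \<one>\<^bsub>Ob Q n\<^esub>"
    using bx y(2) by (simp add: z_def b_def)
  \<comment> \<open>The last premise of \<open>kernel_proj\<close> holds because the differential of
    the cocycle \<open>z\<close> is the unit, which lies in the image of \<open>j\<close>.\<close>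
  then have "z \<in> j n ` carrier (Ob B n)"
    using zc cocycles_subset_Z by (intro kernel_proj) (auto simp: Z_def)
  then obtain t where t: "t \<in> carrier (Ob B n)" "z = j n t"
    by blast
  then have "t \<in> cocycles B n"
    using incl_cocycle[of n t] zc by simp
  moreover have "x = b \<otimes>\<^bsub>Ob D n\<^esub> z"
    using bx by (simp add: z_def p.G.m_assoc[symmetric])
  then have "X = \<iota> n (coh_class B n t)"
    using x zc bc t iota_coh_class[of n t] D.coh_class_eq_iff[of z n x] by auto
  ultimately show "X \<in> \<iota> n ` carrier (cohomology B n)"
    by (auto simp: B.carrier_cohomology)
next
  fix X assume "X \<in> \<iota> n ` carrier (cohomology B n)"
  then obtain t where t: "t \<in> cocycles B n" "X = coh_class D n (j n t)"
    using iota_coh_class[of n] by (auto simp: B.carrier_cohomology B.cocycles_carrier)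
  then have c: "j n t \<in> cocycles D n"
    using incl_cocycle[of n t] B.cocycles_carrier by simp
  have p: "\<pi> n (j n t) = \<one>\<^bsub>Ob Q n\<^esub>"
    using t proj_incl[of n t] B.cocycles_carrier by simp
  have "coh_class Q n \<one>\<^bsub>Ob Q n\<^esub> = \<one>\<^bsub>cohomology Q n\<^esub>"
    using Q.coh_class_eq_one_iff Q.subgroup_coboundaries Q.subgroup_cocycles
    by (simp add: subgroup.one_closed)
  then show "X \<in> kernel (cohomology D n) M \<phi>"
    using t c p by (simp add: kernel_def D.carrier_cohomology phi_coh_class one_M D.cocycles_carrier)
qed

section \<open>The connecting homomorphism\<close>

definition pull where "pull x = inv_into (carrier (Ob B (Suc n))) (j (Suc n)) (df D n x)"

lemma pull:
  assumes "x \<in> Z"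
  shows "pull x \<in> carrier (Ob B (Suc n))" "j (Suc n) (pull x) = df D n x"
  using assms by (auto simp: Z_def pull_def inv_into_into f_inv_into_f)

text \<open>\<open>j\<close> is injective in degree \<open>Suc n\<close>, so the preimage chosen in
  \<open>pull\<close> is the only one.\<close>

lemma pull_eqI:
  "y \<in> carrier (Ob B (Suc n)) \<Longrightarrow> j (Suc n) y = df D n x \<Longrightarrow> pull x = y"
  using incl_inj[of "Suc n"] by (metis inv_into_f_f pull_def zero_less_Suc)

text \<open>The differential of \<open>x\<close> is a cocycle in \<open>D\<close>, and
  \<open>j\<close> reflects cocycles. In \<open>B\<close> the cocycle need not bound, because
  \<open>x\<close> need not come from \<open>B\<close>.\<close>

lemma pull_cocycle:
  assumes "x \<in> Z" shows "pull x \<in> cocycles B (Suc n)"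
proof -
  have "df D n x \<in> cocycles D (Suc n)"
    using D.coboundaries_subset_cocycles[of "Suc n"] assms by (auto simp: coboundaries_def Z_def)
  then show ?thesis
    using pull[OF assms] incl_cocycle[of "Suc n" "pull x"] by simp
qed

lemma pull_mult:
  assumes "x \<in> Z" "y \<in> Z"
  shows "pull (x \<otimes>\<^bsub>Ob D n\<^esub> y) = pull x \<otimes>\<^bsub>Ob B (Suc n)\<^esub> pull y"
proof (rule pull_eqI)
  interpret j: group_hom "Ob B (Suc n)" "Ob D (Suc n)" "j (Suc n)" by (simp add: group_hom_incl)
  interpret d: group_hom "Ob D n" "Ob D (Suc n)" "df D n" by (rule D.group_hom_df)
  show "pull x \<otimes>\<^bsub>Ob B (Suc n)\<^esub> pull y \<in> carrier (Ob B (Suc n))"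
    using pull assms by simp
  show "j (Suc n) (pull x \<otimes>\<^bsub>Ob B (Suc n)\<^esub> pull y) = df D n (x \<otimes>\<^bsub>Ob D n\<^esub> y)"
    using pull[OF assms(1)] pull[OF assms(2)] assms by (simp add: Z_carrier)
qed

abbreviation kernel_iota where
  "kernel_iota \<equiv> kernel (cohomology B (Suc n)) (cohomology D (Suc n)) (\<iota> (Suc n))"

text \<open>The class of a cocycle \<open>t\<close> dies in \<open>D\<close> iff
  \<open>j (Suc n) t\<close> is the differential of some \<open>x\<close>; such an \<open>x\<close>
  lies in \<open>Z\<close> and satisfies \<open>pull x = t\<close>.\<close>

lemma kernel_iota_eq: "kernel_iota = (\<lambda>x. coh_class B (Suc n) (pull x)) ` Z"
proof (intro equalityI subsetI)
  fix X assume "X \<in> kernel_iota"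
  then obtain t where t: "t \<in> cocycles B (Suc n)" "X = coh_class B (Suc n) t"
    and one: "coh_class D (Suc n) (j (Suc n) t) = \<one>\<^bsub>cohomology D (Suc n)\<^esub>"
    using iota_coh_class[of "Suc n"] by (auto simp: kernel_def B.carrier_cohomology B.cocycles_carrier)
  have "j (Suc n) t \<in> coboundaries D (Suc n)"
    using one D.coh_class_eq_one_iff t incl_cocycle[of "Suc n" t] B.cocycles_carrier by blast
  then obtain x where x: "x \<in> carrier (Ob D n)" "j (Suc n) t = df D n x"
    by (auto simp: coboundaries_def)
  moreover have "t \<in> carrier (Ob B (Suc n))"
    using t B.cocycles_carrier by blast
  ultimately have "x \<in> Z" "pull x = t"
    using pull_eqI by (auto simp: Z_def intro: rev_image_eqI)
  then show "X \<in> (\<lambda>x. coh_class B (Suc n) (pull x)) ` Z"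
    using t by auto
next
  fix X assume "X \<in> (\<lambda>x. coh_class B (Suc n) (pull x)) ` Z"
  then obtain x where x: "x \<in> Z" "X = coh_class B (Suc n) (pull x)"
    by blast
  have "df D n x \<in> coboundaries D (Suc n)"
    using x by (auto simp: coboundaries_def Z_def)
  then have "coh_class D (Suc n) (df D n x) = \<one>\<^bsub>cohomology D (Suc n)\<^esub>"
    using D.coh_class_eq_one_iff D.coboundaries_subset_cocycles by blast
  then show "X \<in> kernel_iota"
    using x pull[OF x(1)] pull_cocycle[OF x(1)] iota_coh_class[of "Suc n" "pull x"]
    by (simp add: kernel_def B.carrier_cohomology)
qed

text \<open>It makes \<open>kernel_iota\<close> a subgroup, so that the connecting map has a group
  as its target.\<close>

lemma group_hom_iota: 
  "group_hom (cohomology B (Suc n)) (cohomology D (Suc n)) (\<iota> (Suc n))"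
proof -
  have "\<iota> (Suc n) \<in> hom (cohomology B (Suc n)) (cohomology D (Suc n))"
  proof (rule homI)
    fix X assume "X \<in> carrier (cohomology B (Suc n))"
    then show "\<iota> (Suc n) X \<in> carrier (cohomology D (Suc n))"
      using iota_coh_class[of "Suc n"] incl_cocycle[of "Suc n"]
      by (auto simp: D.carrier_cohomology B.carrier_cohomology B.cocycles_carrier)
  next
    fix X Y assume "X \<in> carrier (cohomology B (Suc n))" "Y \<in> carrier (cohomology B (Suc n))"
    then obtain x y where x: "x \<in> cocycles B (Suc n)" "X = coh_class B (Suc n) x"
      and y: "y \<in> cocycles B (Suc n)" "Y = coh_class B (Suc n) y"
      by (auto simp: B.carrier_cohomology)
    note xy = B.cocycles_carrier[OF x(1)] B.cocycles_carrier[OF y(1)]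
    have "X \<otimes>\<^bsub>cohomology B (Suc n)\<^esub> Y = coh_class B (Suc n) (x \<otimes>\<^bsub>Ob B (Suc n)\<^esub> y)"
      using hom_mult[OF B.coh_class_hom, of x "Suc n" y] x y by simp
    moreover have "x \<otimes>\<^bsub>Ob B (Suc n)\<^esub> y \<in> carrier (Ob B (Suc n))"
      using xy B.group_Ob group.is_monoid monoid.m_closed by metis
    moreover have "j (Suc n) x \<in> cocycles D (Suc n)" "j (Suc n) y \<in> cocycles D (Suc n)"
      using x y xy incl_cocycle[of "Suc n"] by auto
    ultimately show "\<iota> (Suc n) (X \<otimes>\<^bsub>cohomology B (Suc n)\<^esub> Y)
        = \<iota> (Suc n) X \<otimes>\<^bsub>cohomology D (Suc n)\<^esub> \<iota> (Suc n) Y"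
      using x y xy iota_coh_class[of "Suc n"] hom_mult[OF incl_hom[of "Suc n"] xy]
        hom_mult[OF D.coh_class_hom, of "j (Suc n) x" "Suc n" "j (Suc n) y"]
      by simp
  qed
  then show ?thesis
    by (simp add: B.group_cohomology D.group_cohomology group_hom.intro group_hom_axioms.intro)
qed

lemma group_hom_conn:
  "group_hom ((Ob D n)\<lparr>carrier := Z\<rparr>) ((cohomology B (Suc n))\<lparr>carrier := kernel_iota\<rparr>)
     (\<lambda>x. coh_class B (Suc n) (pull x))"
proof -
  have "(\<lambda>x. coh_class B (Suc n) (pull x))
      \<in> hom ((Ob D n)\<lparr>carrier := Z\<rparr>) ((cohomology B (Suc n))\<lparr>carrier := kernel_iota\<rparr>)"
    using hom_mult[OF B.coh_class_hom, of _ "Suc n"]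
    by (intro homI) (auto simp: kernel_iota_eq pull_mult pull_cocycle)
  moreover have "group ((cohomology B (Suc n))\<lparr>carrier := kernel_iota\<rparr>)"
    by (rule subgroup.subgroup_is_group[OF group_hom.subgroup_kernel[OF group_hom_iota] B.group_cohomology])
  ultimately show ?thesis
    by (simp add: group_Z group_hom_def group_hom_axioms_def)
qed

text \<open>The comparison of kernels behind the cokernel isomorphism: the obstruction class of
  \<open>x\<close> vanishes exactly when the class of its projection comes from a cocycle of
  \<open>D\<close>.\<close>

lemma conn_eq_one_iff:
  assumes x: "x \<in> Z"
  shows "coh_class B (Suc n) (pull x) = \<one>\<^bsub>cohomology B (Suc n)\<^esub>
    \<longleftrightarrow> coh_class Q n (\<pi> n x) \<in> \<phi> ` carrier (cohomology D n)"
proof -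
  interpret p: group_hom "Ob D n" "Ob Q n" "\<pi> n" by (rule group_hom_proj)
  interpret d: group_hom "Ob D n" "Ob D (Suc n)" "df D n" by (rule D.group_hom_df)
  interpret d': group_hom "Ob D m" "Ob D n" "df D m" by (rule D.group_hom_df)
  interpret D: comm_group "Ob D n" by (rule D.comm_group_Ob)
  have xc: "x \<in> carrier (Ob D n)"
    using x by (rule Z_carrier)
  show ?thesis
  proof
    assume "coh_class B (Suc n) (pull x) = \<one>\<^bsub>cohomology B (Suc n)\<^esub>"
    then have "pull x \<in> coboundaries B (Suc n)"
      using B.coh_class_eq_one_iff pull_cocycle x by blast
    then obtain t where t: "t \<in> carrier (Ob B n)" "pull x = df B n t"
      by (auto simp: coboundaries_def)
    have jt: "j n t \<in> carrier (Ob D n)" "df D n (j n t) = df D n x"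
      using t pull[OF x] incl_df[of n t] incl_closed[of n t] by auto
    \<comment> \<open>\<open>j n t\<close> has the same differential as \<open>x\<close> and trivial
      projection, so dividing by it turns \<open>x\<close> into a cocycle without changing the
      projection.\<close>
    define z where "z = inv\<^bsub>Ob D n\<^esub> (j n t) \<otimes>\<^bsub>Ob D n\<^esub> x"
    have "z \<in> cocycles D n"
      using jt xc by (simp add: z_def cocycles_def kernel_def)
    moreover have "\<pi> n z = \<pi> n x"
      using jt xc t proj_incl[of n t] by (simp add: z_def proj_closed)
    ultimately show "coh_class Q n (\<pi> n x) \<in> \<phi> ` carrier (cohomology D n)"
      by (metis D.carrier_cohomology D.cocycles_carrier image_eqI phi_coh_class)
  next
    assume "coh_class Q n (\<pi> n x) \<in> \<phi> ` carrier (cohomology D n)"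
    then obtain z where z: "z \<in> cocycles D n" "coh_class Q n (\<pi> n z) = coh_class Q n (\<pi> n x)"
      by (auto simp: D.carrier_cohomology phi_coh_class D.cocycles_carrier)
    have zZ: "z \<in> Z" using z cocycles_subset_Z by blast
    have zc: "z \<in> carrier (Ob D n)" using zZ by (rule Z_carrier)
    obtain b where b: "b \<in> coboundaries Q n" "\<pi> n x = b \<otimes>\<^bsub>Ob Q n\<^esub> \<pi> n z"
      using z Q.coh_class_eq_iff proj_cocycle x zZ by blast
    then obtain y where y: "y \<in> carrier (Ob D m)" "b = \<pi> n (df D m y)"
      using coboundary_lift by blast
    \<comment> \<open>Equality of classes is improved to equality of projections: the cocycle
      \<open>z\<close> is multiplied by a lift of the coboundary \<open>b\<close>.\<close>
    define w where "w = df D m y \<otimes>\<^bsub>Ob D n\<^esub> z"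
    have w: "w \<in> carrier (Ob D n)" "\<pi> n w = \<pi> n x" "df D n w = \<one>\<^bsub>Ob D (Suc n)\<^esub>"
      using y b zc z by (auto simp: w_def D.df_df cocycles_def kernel_def)
    have wZ: "w \<in> Z"
      using w cocycles_subset_Z by (auto simp: cocycles_def kernel_def)
    \<comment> \<open>\<open>s\<close> lies in \<open>Z\<close> and has trivial projection, hence
      comes from \<open>B\<close>; since \<open>w\<close> is a cocycle, \<open>s\<close> and
      \<open>x\<close> have the same differential.\<close>
    define s where "s = inv\<^bsub>Ob D n\<^esub> w \<otimes>\<^bsub>Ob D n\<^esub> x"
    have sZ: "s \<in> Z"
      unfolding s_def using wZ x subgroup_Z by (simp add: subgroup.m_closed subgroup.m_inv_closed)
    have "\<pi> n s = \<one>\<^bsub>Ob Q n\<^esub>"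
      using w xc by (simp add: s_def proj_closed)
    then obtain t where t: "t \<in> carrier (Ob B n)" "s = j n t"
      using kernel_proj[of s] sZ by (auto simp: Z_def)
    have "df D n s = df D n x"
      using w xc by (simp add: s_def)
    then have "pull x = df B n t"
      using t incl_df[of n t] hom_in_carrier[OF B.df_hom t(1)] by (intro pull_eqI) auto
    then have "pull x \<in> coboundaries B (Suc n)"
      using t by (simp add: coboundaries_def)
    then show "coh_class B (Suc n) (pull x) = \<one>\<^bsub>cohomology B (Suc n)\<^esub>"
      using B.coh_class_eq_one_iff pull_cocycle x by blast
  qed
qed

text \<open>Two surjections from \<open>Z\<close> are compared: the class of
  \<open>\<pi> n x\<close> modulo the image of \<open>\<phi>\<close>, and the class of
  \<open>pull x\<close>. By \<open>conn_eq_one_iff\<close> their kernels agree.\<close>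

theorem cokernel_iso:
  "M Mod (\<phi> ` carrier (cohomology D n)) \<cong> (cohomology B (Suc n))\<lparr>carrier := kernel_iota\<rparr>"
proof (rule iso_of_kernel_eq)
  let ?N = "\<phi> ` carrier (cohomology D n)"
  let ?u = "\<lambda>x. coh_class Q n (\<pi> n x)"
  have N: "subgroup ?N M"
    by (rule group_hom.img_is_subgroup[OF group_hom_phi])
  then interpret N: normal ?N M
    by (simp add: comm_group_M comm_group.normal_iff_subgroup)
  interpret u: group_hom "(Ob D n)\<lparr>carrier := Z\<rparr>" M ?u by (rule group_hom_class_proj)
  show "group_hom ((Ob D n)\<lparr>carrier := Z\<rparr>) (M Mod ?N) (\<lambda>x. ?N #>\<^bsub>M\<^esub> ?u x)"
    using hom_compose[OF u.homh N.r_coset_hom_Mod] group_Z N.factorgroup_is_group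
    by (simp add: group_hom_def group_hom_axioms_def comp_def)
  show "group_hom ((Ob D n)\<lparr>carrier := Z\<rparr>) ((cohomology B (Suc n))\<lparr>carrier := kernel_iota\<rparr>)
     (\<lambda>x. coh_class B (Suc n) (pull x))"
    by (rule group_hom_conn)
  show "(\<lambda>x. ?N #>\<^bsub>M\<^esub> ?u x) ` carrier ((Ob D n)\<lparr>carrier := Z\<rparr>) = carrier (M Mod ?N)"
    unfolding carrier_FactGroup by (auto simp: M_def)
  show "(\<lambda>x. coh_class B (Suc n) (pull x)) ` carrier ((Ob D n)\<lparr>carrier := Z\<rparr>)
      = carrier ((cohomology B (Suc n))\<lparr>carrier := kernel_iota\<rparr>)"
    by (simp add: kernel_iota_eq)
  have "?N #>\<^bsub>M\<^esub> ?u x = ?N \<longleftrightarrow> ?u x \<in> ?N" if "x \<in> Z" for x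
  proof -
    have "?u x \<in> carrier M"
      using that by (simp add: M_def)
    then show ?thesis
      using group.coset_join1[OF group_M _ _ N] group.coset_join2[OF group_M _ N] by blast
  qed
  then show "kernel ((Ob D n)\<lparr>carrier := Z\<rparr>) (M Mod ?N) (\<lambda>x. ?N #>\<^bsub>M\<^esub> ?u x)
    = kernel ((Ob D n)\<lparr>carrier := Z\<rparr>) ((cohomology B (Suc n))\<lparr>carrier := kernel_iota\<rparr>)
       (\<lambda>x. coh_class B (Suc n) (pull x))"
    by (simp add: kernel_def conn_eq_one_iff cong: conj_cong)
qed

end

section \<open>Total complexes and quotients of double complexes\<close>

text \<open>The two differentials commute; the sign that makes the total differential square to the
  unit comes in with \<open>Tot\<close>.\<close>

locale double_complex =
  fixes X :: "'a dcplx"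
  assumes comm_group_DOb: "comm_group (DOb X p q)"
    and dh_hom: "dh X p q \<in> hom (DOb X p q) (DOb X (Suc p) q)"
    and dv_hom: "dv X p q \<in> hom (DOb X p q) (DOb X p (Suc q))"
    and dh_dh: "x \<in> carrier (DOb X p q) \<Longrightarrow> dh X (Suc p) q (dh X p q x) = \<one>\<^bsub>DOb X (Suc (Suc p)) q\<^esub>"
    and dv_dv: "x \<in> carrier (DOb X p q) \<Longrightarrow> dv X p (Suc q) (dv X p q x) = \<one>\<^bsub>DOb X p (Suc (Suc q))\<^esub>"
    and dh_dv: "x \<in> carrier (DOb X p q) \<Longrightarrow> dh X p (Suc q) (dv X p q x) = dv X (Suc p) q (dh X p q x)"
begin

lemma group_DOb: "group (DOb X p q)"
  using comm_group_DOb comm_group.axioms(2) by blast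

lemma dh_closed: "x \<in> carrier (DOb X p q) \<Longrightarrow> dh X p q x \<in> carrier (DOb X (Suc p) q)"
  using dh_hom hom_in_carrier by metis

lemma dv_closed: "x \<in> carrier (DOb X p q) \<Longrightarrow> dv X p q x \<in> carrier (DOb X p (Suc q))"
  using dv_hom hom_in_carrier by metis

lemma dh_int_pow:
  "x \<in> carrier (DOb X p q) \<Longrightarrow>
    dh X p q (x [^]\<^bsub>DOb X p q\<^esub> (k::int)) = dh X p q x [^]\<^bsub>DOb X (Suc p) q\<^esub> k"
  by (simp add: hom_int_pow[OF dh_hom] group_DOb)

lemma dv_int_pow:
  "x \<in> carrier (DOb X p q) \<Longrightarrow>
    dv X p q (x [^]\<^bsub>DOb X p q\<^esub> (k::int)) = dv X p q x [^]\<^bsub>DOb X p (Suc q)\<^esub> k"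
  by (simp add: hom_int_pow[OF dv_hom] group_DOb)

lemma m_closed [simp]:
  "x \<in> carrier (DOb X p q) \<Longrightarrow> y \<in> carrier (DOb X p q) \<Longrightarrow> x \<otimes>\<^bsub>DOb X p q\<^esub> y \<in> carrier (DOb X p q)"
  by (simp add: group_DOb group.is_monoid monoid.m_closed)

lemma int_pow_closed [simp]:
  "x \<in> carrier (DOb X p q) \<Longrightarrow> x [^]\<^bsub>DOb X p q\<^esub> (k::int) \<in> carrier (DOb X p q)"
  by (simp add: group_DOb group.int_pow_closed)

lemma one_closed [simp]: "\<one>\<^bsub>DOb X p q\<^esub> \<in> carrier (DOb X p q)"
  by (simp add: group_DOb group.is_monoid monoid.one_closed)

lemma l_one [simp]: "x \<in> carrier (DOb X p q) \<Longrightarrow> \<one>\<^bsub>DOb X p q\<^esub> \<otimes>\<^bsub>DOb X p q\<^esub> x = x"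
  by (simp add: group_DOb group.is_monoid monoid.l_one)

lemma r_one [simp]: "x \<in> carrier (DOb X p q) \<Longrightarrow> x \<otimes>\<^bsub>DOb X p q\<^esub> \<one>\<^bsub>DOb X p q\<^esub> = x"
  by (simp add: group_DOb group.is_monoid monoid.r_one)

lemma one_int_pow [simp]: "\<one>\<^bsub>DOb X p q\<^esub> [^]\<^bsub>DOb X p q\<^esub> (k::int) = \<one>\<^bsub>DOb X p q\<^esub>"
  by (simp add: group_DOb group.int_pow_one)

lemma int_pow_1 [simp]: "x \<in> carrier (DOb X p q) \<Longrightarrow> x [^]\<^bsub>DOb X p q\<^esub> (1::int) = x"
  by (simp add: group_DOb group.int_pow_1)

section \<open>The total complex of a double complex\<close>

lemma Ob_Tot: "Ob (Tot X) n = product_group {..n} (\<lambda>q. DOb X (n - q) q)"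
  by (simp add: Tot_def)

text \<open>Writing the total degree as \<open>p + q\<close> avoids truncated subtraction: the
  bidegree \<open>(n - q, q)\<close> simplifies to \<open>(p, q)\<close>.\<close>

lemma Tot_mem: "x \<in> carrier (Ob (Tot X) (p + q)) \<Longrightarrow> x q \<in> carrier (DOb X p q)"
  by (auto simp: Ob_Tot dest!: PiE_mem[of _ _ _ q])

lemma Tot_mem_mid:
  assumes "x \<in> carrier (Ob (Tot X) (p + Suc q))"
  shows "x (Suc q) \<in> carrier (DOb X p (Suc q))" "x q \<in> carrier (DOb X (Suc p) q)"
  using Tot_mem[of x p "Suc q"] Tot_mem[of x "Suc p" q] assms by simp_all

lemma Tot_memI:
  assumes "x \<in> extensional {..n}" "\<And>p q. n = p + q \<Longrightarrow> x q \<in> carrier (DOb X p q)"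
  shows "x \<in> carrier (Ob (Tot X) n)"
  using assms by (auto simp: Ob_Tot PiE_iff)

lemma Tot_eqI:
  assumes "x \<in> carrier (Ob (Tot X) n)" "y \<in> carrier (Ob (Tot X) n)"
    and "\<And>p q. n = p + q \<Longrightarrow> x q = y q"
  shows "x = y"
proof (rule PiE_ext)
  show "x \<in> (\<Pi>\<^sub>E q\<in>{..n}. carrier (DOb X (n - q) q))" "y \<in> (\<Pi>\<^sub>E q\<in>{..n}. carrier (DOb X (n - q) q))"
    using assms by (simp_all add: Ob_Tot)
  show "x q = y q" if "q \<in> {..n}" for q
    using that assms(3)[of "n - q" q] by simp
qed

lemma Tot_one: "\<one>\<^bsub>Ob (Tot X) (p + q)\<^esub> q = \<one>\<^bsub>DOb X p q\<^esub>"
  by (simp add: Ob_Tot)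

lemma Tot_mult: "(x \<otimes>\<^bsub>Ob (Tot X) (p + q)\<^esub> y) q = x q \<otimes>\<^bsub>DOb X p q\<^esub> y q"
  by (simp add: Ob_Tot)

lemma comm_group_Tot: "comm_group (Ob (Tot X) n)"
proof (rule group.group_comm_groupI)
  show "group (Ob (Tot X) n)"
    by (simp add: Ob_Tot group_DOb)
  show "x \<otimes>\<^bsub>Ob (Tot X) n\<^esub> y = y \<otimes>\<^bsub>Ob (Tot X) n\<^esub> x"
    if "x \<in> carrier (Ob (Tot X) n)" "y \<in> carrier (Ob (Tot X) n)" for x y
    using that comm_groupE(4)[OF comm_group_DOb] by (auto simp: Ob_Tot PiE_iff intro!: restrict_ext)
qed

lemma Tot_df_0:
  "x \<in> carrier (Ob (Tot X) n) \<Longrightarrow> df (Tot X) n x 0 = dh X n 0 (x 0)"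
  using Tot_mem[of x n 0] by (simp add: Tot_def dh_closed)

lemma Tot_df_mid:
  "df (Tot X) (p + Suc q) x (Suc q) = dh X p (Suc q) (x (Suc q))
     \<otimes>\<^bsub>DOb X (Suc p) (Suc q)\<^esub> dv X (Suc p) q (x q) [^]\<^bsub>DOb X (Suc p) (Suc q)\<^esub> ((-1::int) ^ Suc p)"
proof -
  have "Suc (p + q) - q = Suc p" by simp
  then show ?thesis by (simp add: Tot_def)
qed

text \<open>The horizontal degree is 0 here, so the sign is \<open>(-1) ^ 0\<close> and the vertical
  differential appears unchanged.\<close>

lemma Tot_df_top:
  "x \<in> carrier (Ob (Tot X) n) \<Longrightarrow> df (Tot X) n x (Suc n) = dv X 0 n (x n)"
  using Tot_mem[of x 0 n] by (simp add: Tot_def dv_closed)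

text \<open>At the two edges only one differential contributes; the three cases match
  \<open>Tot_df_0\<close>, \<open>Tot_df_mid\<close> and \<open>Tot_df_top\<close>.\<close>

lemma Tot_df_cases:
  assumes "Suc n = p + q"
  obtains "q = 0" "p = Suc n" | p' q' where "p = Suc p'" "q = Suc q'" "n = p' + Suc q'"
    | "p = 0" "q = Suc n"
  using assms by (cases q; cases p) auto

lemma Tot_df_closed:
  assumes x: "x \<in> carrier (Ob (Tot X) n)"
  shows "df (Tot X) n x \<in> carrier (Ob (Tot X) (Suc n))"
proof (rule Tot_memI)
  show "df (Tot X) n x \<in> extensional {..Suc n}"
    by (simp add: Tot_def)
  fix p q assume "Suc n = p + q"
  then show "df (Tot X) n x q \<in> carrier (DOb X p q)"
  proof (cases rule: Tot_df_cases)
    case 1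
    then show ?thesis using x Tot_mem[of x n 0] by (simp add: Tot_df_0 dh_closed)
  next
    case (2 p' q')
    then show ?thesis
      using Tot_mem_mid[of x p' q'] x unfolding 2(1,2) unfolding 2(3) Tot_df_mid
      by (simp add: dh_closed dv_closed)
  next
    case 3
    then show ?thesis using x Tot_mem[of x 0 n] by (simp add: Tot_df_top dv_closed)
  qed
qed

lemma Tot_df_hom: "df (Tot X) n \<in> hom (Ob (Tot X) n) (Ob (Tot X) (Suc n))"
proof (rule homI)
  fix x y assume x: "x \<in> carrier (Ob (Tot X) n)" and y: "y \<in> carrier (Ob (Tot X) n)"
  have xy: "x \<otimes>\<^bsub>Ob (Tot X) n\<^esub> y \<in> carrier (Ob (Tot X) n)"
    using x y comm_group_Tot comm_groupE(1) by metis
  show "df (Tot X) n (x \<otimes>\<^bsub>Ob (Tot X) n\<^esub> y)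
      = df (Tot X) n x \<otimes>\<^bsub>Ob (Tot X) (Suc n)\<^esub> df (Tot X) n y"
  proof (rule Tot_eqI)
    show "df (Tot X) n (x \<otimes>\<^bsub>Ob (Tot X) n\<^esub> y) \<in> carrier (Ob (Tot X) (Suc n))"
      using xy by (rule Tot_df_closed)
    show "df (Tot X) n x \<otimes>\<^bsub>Ob (Tot X) (Suc n)\<^esub> df (Tot X) n y \<in> carrier (Ob (Tot X) (Suc n))"
      using x y comm_group_Tot comm_groupE(1) Tot_df_closed by metis
    fix p q assume pq: "Suc n = p + q"
    have c: "(df (Tot X) n x \<otimes>\<^bsub>Ob (Tot X) (Suc n)\<^esub> df (Tot X) n y) q
        = df (Tot X) n x q \<otimes>\<^bsub>DOb X p q\<^esub> df (Tot X) n y q"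
      by (simp add: pq Tot_mult)
    show "df (Tot X) n (x \<otimes>\<^bsub>Ob (Tot X) n\<^esub> y) q
        = (df (Tot X) n x \<otimes>\<^bsub>Ob (Tot X) (Suc n)\<^esub> df (Tot X) n y) q"
      using pq
    proof (cases rule: Tot_df_cases)
      case 1
      then show ?thesis
        using x y xy Tot_mem[of x n 0] Tot_mem[of y n 0] Tot_mult[of n 0 x y] unfolding c
        by (simp add: Tot_df_0 hom_mult[OF dh_hom])
    next
      case (2 p' q')
      interpret C: comm_group "DOb X (Suc p') (Suc q')" by (rule comm_group_DOb)
      have cl: "dh X p' (Suc q') (z (Suc q')) \<in> carrier (DOb X (Suc p') (Suc q'))"
        "dv X (Suc p') q' (z q') \<in> carrier (DOb X (Suc p') (Suc q'))"
        if "z \<in> carrier (Ob (Tot X) n)" for z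
        using that Tot_mem_mid[of z p' q'] 2 by (simp_all add: dh_closed dv_closed)
      have "(x \<otimes>\<^bsub>Ob (Tot X) n\<^esub> y) (Suc q') = x (Suc q') \<otimes>\<^bsub>DOb X p' (Suc q')\<^esub> y (Suc q')"
        "(x \<otimes>\<^bsub>Ob (Tot X) n\<^esub> y) q' = x q' \<otimes>\<^bsub>DOb X (Suc p') q'\<^esub> y q'"
        using Tot_mult[of p' "Suc q'" x y] Tot_mult[of "Suc p'" q' x y] 2 by simp_all
      then show ?thesis
        unfolding c unfolding 2(1,2) unfolding 2(3) Tot_df_mid
        using x y cl[of x] cl[of y] Tot_mem_mid[of x p' q'] Tot_mem_mid[of y p' q'] 2
        by (simp add: hom_mult[OF dh_hom] hom_mult[OF dv_hom] C.int_pow_distrib C.m_ac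
            del: add_Suc_right)
    next
      case 3
      then show ?thesis
        using x y xy Tot_mem[of x 0 n] Tot_mem[of y 0 n] Tot_mult[of 0 n x y] unfolding c
        by (simp add: Tot_df_top hom_mult[OF dv_hom])
    qed
  qed
qed (rule Tot_df_closed)

text \<open>\<open>dv_dv\<close> removes the vertical summand and leaves the mixed term.\<close>

lemma dv_Tot_df:
  assumes x: "x \<in> carrier (Ob (Tot X) (p + q))"
  shows "dv X (Suc p) q (df (Tot X) (p + q) x q) = dv X (Suc p) q (dh X p q (x q))"
proof (cases q)
  case 0
  then show ?thesis using x by (simp add: Tot_df_0)
next
  case (Suc q')
  show ?thesis
    unfolding Suc Tot_df_mid using Tot_mem_mid[of x p q'] x Suc
    by (simp add: hom_mult[OF dv_hom] dh_closed dv_closed dv_int_pow dv_dv)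
qed

text \<open>Here \<open>dh_dh\<close> removes the horizontal summand; the mixed term keeps the sign
  of the vertical one.\<close>

lemma dh_Tot_df:
  assumes x: "x \<in> carrier (Ob (Tot X) (p + q))"
  shows "dh X p (Suc q) (df (Tot X) (p + q) x (Suc q))
    = dh X p (Suc q) (dv X p q (x q)) [^]\<^bsub>DOb X (Suc p) (Suc q)\<^esub> ((-1::int) ^ p)"
proof (cases p)
  case 0
  then show ?thesis using x Tot_mem[OF x] by (simp add: Tot_df_top dh_closed dv_closed)
next
  case (Suc p')
  have "df (Tot X) (p + q) x (Suc q) = df (Tot X) (p' + Suc q) x (Suc q)"
    by (simp add: Suc)
  moreover have "x (Suc q) \<in> carrier (DOb X p' (Suc q))" "x q \<in> carrier (DOb X (Suc p') q)"
    using x Tot_mem_mid[of x p' q] Suc by simp_all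
  ultimately show ?thesis
    unfolding Tot_df_mid using Suc
    by (simp add: hom_mult[OF dh_hom] dh_closed dv_closed dh_int_pow dh_dh)
qed

lemma Tot_df_df:
  assumes x: "x \<in> carrier (Ob (Tot X) n)"
  shows "df (Tot X) (Suc n) (df (Tot X) n x) = \<one>\<^bsub>Ob (Tot X) (Suc (Suc n))\<^esub>"
proof (rule Tot_eqI)
  note dx = Tot_df_closed[OF x]
  show "df (Tot X) (Suc n) (df (Tot X) n x) \<in> carrier (Ob (Tot X) (Suc (Suc n)))"
    using dx by (rule Tot_df_closed)
  show "\<one>\<^bsub>Ob (Tot X) (Suc (Suc n))\<^esub> \<in> carrier (Ob (Tot X) (Suc (Suc n)))"
    using comm_group_Tot comm_groupE(2) by blast
  fix p q assume pq: "Suc (Suc n) = p + q"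
  have one: "\<one>\<^bsub>Ob (Tot X) (Suc (Suc n))\<^esub> q = \<one>\<^bsub>DOb X p q\<^esub>"
    by (simp add: pq Tot_one)
  show "df (Tot X) (Suc n) (df (Tot X) n x) q = \<one>\<^bsub>Ob (Tot X) (Suc (Suc n))\<^esub> q"
    using pq
  proof (cases rule: Tot_df_cases)
    case 1
    then show ?thesis
      using x dx Tot_mem[of x n 0] unfolding one by (simp add: Tot_df_0 dh_dh)
  next
    case (2 p' q')
    then have n: "n = p' + q'" by simp
    interpret C: group "DOb X (Suc p') (Suc q')" by (rule group_DOb)
    have xq: "x q' \<in> carrier (DOb X p' q')"
      using x Tot_mem n by blast
    \<comment> \<open>By \<open>dh_dv\<close> both mixed terms are powers of \<open>v\<close>, with
      opposite exponents.\<close>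
    define v where "v = dv X (Suc p') q' (dh X p' q' (x q'))"
    have v: "v \<in> carrier (DOb X (Suc p') (Suc q'))"
      using xq by (simp add: v_def dh_closed dv_closed)
    have "df (Tot X) (Suc n) (df (Tot X) n x) q
        = v [^]\<^bsub>DOb X (Suc p') (Suc q')\<^esub> ((-1::int) ^ p')
          \<otimes>\<^bsub>DOb X (Suc p') (Suc q')\<^esub> v [^]\<^bsub>DOb X (Suc p') (Suc q')\<^esub> ((-1::int) ^ Suc p')"
      using dv_Tot_df[of x p' q'] dh_Tot_df[of x p' q'] dh_dv[OF xq] x
      unfolding 2(1,2) unfolding 2(3) Tot_df_mid unfolding n v_def by simp
    also have "\<dots> = \<one>\<^bsub>DOb X (Suc p') (Suc q')\<^esub>"
      using v by (simp add: C.int_pow_neg)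
    finally show ?thesis
      unfolding one by (simp add: 2)
  next
    case 3
    then show ?thesis
      using x dx Tot_mem[of x 0 n] unfolding one by (simp add: Tot_df_top dv_dv)
  qed
qed

lemma cochain_complex_Tot: "cochain_complex (Tot X)"
  by (rule cochain_complex.intro) (simp_all add: comm_group_Tot Tot_df_hom Tot_df_df)

end

locale sub_double_complex = double_complex X for X :: "'a dcplx" +
  fixes S :: "'a dcplx"
  assumes subgroup_S: "subgroup (carrier (DOb S p q)) (DOb X p q)"
    and dh_S: "dh X p q ` carrier (DOb S p q) \<subseteq> carrier (DOb S (Suc p) q)"
    and dv_S: "dv X p q ` carrier (DOb S p q) \<subseteq> carrier (DOb S p (Suc q))"
begin

abbreviation Y where "Y \<equiv> quot_dcplx X S"

definition cls where "cls p q x = carrier (DOb S p q) #>\<^bsub>DOb X p q\<^esub> x"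

lemma normal_S: "carrier (DOb S p q) \<lhd> DOb X p q"
  by (simp add: comm_group.normal_iff_subgroup comm_group_DOb subgroup_S)

lemma DOb_Y: "DOb Y p q = DOb X p q Mod carrier (DOb S p q)"
  by (simp add: quot_dcplx_def)

lemma comm_group_DOb_Y: "comm_group (DOb Y p q)"
  unfolding DOb_Y by (simp add: comm_group.abelian_FactGroup comm_group_DOb subgroup_S)

lemma group_DOb_Y: "group (DOb Y p q)"
  using comm_group_DOb_Y comm_group.axioms(2) by blast

lemma cls_hom: "cls p q \<in> hom (DOb X p q) (DOb Y p q)"
  unfolding DOb_Y cls_def[abs_def] by (rule normal.r_coset_hom_Mod[OF normal_S])

lemma carrier_DOb_Y: "carrier (DOb Y p q) = cls p q ` carrier (DOb X p q)"
  by (simp add: DOb_Y carrier_FactGroup cls_def)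

lemma dh_cls: "x \<in> carrier (DOb X p q) \<Longrightarrow> dh Y p q (cls p q x) = cls (Suc p) q (dh X p q x)"
  by (simp add: quot_dcplx_def cls_def coset_map_r_coset group_DOb dh_hom subgroup_S dh_S)

lemma dv_cls: "x \<in> carrier (DOb X p q) \<Longrightarrow> dv Y p q (cls p q x) = cls p (Suc q) (dv X p q x)"
  by (simp add: quot_dcplx_def cls_def coset_map_r_coset group_DOb dv_hom subgroup_S dv_S)

lemma cls_one: "cls p q \<one>\<^bsub>DOb X p q\<^esub> = \<one>\<^bsub>DOb Y p q\<^esub>"
  by (simp add: hom_one[OF cls_hom] group_DOb group_DOb_Y)

lemma cls_eq_one_iff:
  "x \<in> carrier (DOb X p q) \<Longrightarrow> cls p q x = \<one>\<^bsub>DOb Y p q\<^esub> \<longleftrightarrow> x \<in> carrier (DOb S p q)"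
  using group.coset_join1[OF group_DOb _ _ subgroup_S] group.coset_join2[OF group_DOb _ subgroup_S]
  by (auto simp: cls_def DOb_Y)

text \<open>Every element of the quotient is the class of some element, and taking classes commutes
  with the operations, so each law of \<open>X\<close> descends.\<close>

lemma double_complex_Y: "double_complex Y"
proof (rule double_complex.intro)
  fix p q
  show "comm_group (DOb Y p q)" by (rule comm_group_DOb_Y)
  show "dh Y p q \<in> hom (DOb Y p q) (DOb Y (Suc p) q)"
    by (rule homI) (auto simp: carrier_DOb_Y dh_cls dh_closed hom_mult[OF cls_hom, symmetric]
        hom_mult[OF dh_hom])
  show "dv Y p q \<in> hom (DOb Y p q) (DOb Y p (Suc q))"
    by (rule homI) (auto simp: carrier_DOb_Y dv_cls dv_closed hom_mult[OF cls_hom, symmetric]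
        hom_mult[OF dv_hom])
  fix x assume "x \<in> carrier (DOb Y p q)"
  then show "dh Y (Suc p) q (dh Y p q x) = \<one>\<^bsub>DOb Y (Suc (Suc p)) q\<^esub>"
    "dv Y p (Suc q) (dv Y p q x) = \<one>\<^bsub>DOb Y p (Suc (Suc q))\<^esub>"
    "dh Y p (Suc q) (dv Y p q x) = dv Y (Suc p) q (dh Y p q x)"
    by (auto simp: carrier_DOb_Y dh_cls dv_cls dh_closed dv_closed dh_dh dv_dv dh_dv cls_one)
qed

sublocale Y: double_complex Y
  by (rule double_complex_Y)

section \<open>The projection onto the total complex of the quotient\<close>

lemma Tot_proj_apply: "Tot_proj X S (p + q) x q = cls p q (x q)"
  by (simp add: Tot_proj_def cls_def)

lemma Tot_proj_closed:
  assumes "x \<in> carrier (Ob (Tot X) n)"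
  shows "Tot_proj X S n x \<in> carrier (Ob (Tot Y) n)"
  using assms Tot_mem by (auto simp: Tot_proj_apply carrier_DOb_Y intro!: Y.Tot_memI)
    (simp add: Tot_proj_def)

lemma Tot_proj_hom: "Tot_proj X S n \<in> hom (Ob (Tot X) n) (Ob (Tot Y) n)"
proof (rule homI)
  fix x y assume x: "x \<in> carrier (Ob (Tot X) n)" and y: "y \<in> carrier (Ob (Tot X) n)"
  have xy: "x \<otimes>\<^bsub>Ob (Tot X) n\<^esub> y \<in> carrier (Ob (Tot X) n)"
    using x y comm_group_Tot comm_groupE(1) by metis
  show "Tot_proj X S n (x \<otimes>\<^bsub>Ob (Tot X) n\<^esub> y) = Tot_proj X S n x \<otimes>\<^bsub>Ob (Tot Y) n\<^esub> Tot_proj X S n y"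
  proof (rule Y.Tot_eqI[OF Tot_proj_closed[OF xy]])
    show "Tot_proj X S n x \<otimes>\<^bsub>Ob (Tot Y) n\<^esub> Tot_proj X S n y \<in> carrier (Ob (Tot Y) n)"
      using x y Y.comm_group_Tot comm_groupE(1) Tot_proj_closed by metis
    fix p q assume n: "n = p + q"
    show "Tot_proj X S n (x \<otimes>\<^bsub>Ob (Tot X) n\<^esub> y) q
        = (Tot_proj X S n x \<otimes>\<^bsub>Ob (Tot Y) n\<^esub> Tot_proj X S n y) q"
      using x y Tot_mem unfolding n by (simp add: Tot_mult Y.Tot_mult Tot_proj_apply hom_mult[OF cls_hom])
  qed
qed (rule Tot_proj_closed)

lemma Tot_proj_surj: "Tot_proj X S n ` carrier (Ob (Tot X) n) = carrier (Ob (Tot Y) n)"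
proof (intro equalityI subsetI)
  fix y assume y: "y \<in> carrier (Ob (Tot Y) n)"
  \<comment> \<open>Stated for every \<open>q\<close>, with no condition on the value beyond
    \<open>n\<close>, so that it yields a choice function on all indices.\<close>
  have "\<exists>z\<in>carrier (DOb X (n - q) q). q \<le> n \<longrightarrow> y q = cls (n - q) q z" for q
  proof (cases "q \<le> n")
    case True
    then show ?thesis
      using Y.Tot_mem[of y "n - q" q] y by (auto simp: carrier_DOb_Y)
  qed (auto intro: one_closed)
  then obtain z where z: "\<And>q. z q \<in> carrier (DOb X (n - q) q)"
    "\<And>q. q \<le> n \<Longrightarrow> y q = cls (n - q) q (z q)"
    by metis
  \<comment> \<open>Elements of a product group are \<open>undefined\<close> outside the index set,
    hence the restriction.\<close>
  define x where "x = restrict z {..n}"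
  have x: "x \<in> carrier (Ob (Tot X) n)"
    using z(1) by (simp add: Ob_Tot x_def)
  have "y = Tot_proj X S n x"
  proof (rule Y.Tot_eqI[OF y Tot_proj_closed[OF x]])
    fix p q assume "n = p + q"
    then show "y q = Tot_proj X S n x q"
      using z(2)[of q] by (simp add: Tot_proj_apply x_def)
  qed
  then show "y \<in> Tot_proj X S n ` carrier (Ob (Tot X) n)"
    using x by blast
qed (use Tot_proj_closed in auto)

lemma Tot_proj_df:
  assumes x: "x \<in> carrier (Ob (Tot X) n)"
  shows "Tot_proj X S (Suc n) (df (Tot X) n x) = df (Tot Y) n (Tot_proj X S n x)"
proof (rule Y.Tot_eqI[OF Tot_proj_closed[OF Tot_df_closed[OF x]] Y.Tot_df_closed[OF Tot_proj_closed[OF x]]])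
  fix p q assume pq: "Suc n = p + q"
  have c: "Tot_proj X S (Suc n) (df (Tot X) n x) q = cls p q (df (Tot X) n x q)"
    by (simp add: pq Tot_proj_apply)
  show "Tot_proj X S (Suc n) (df (Tot X) n x) q = df (Tot Y) n (Tot_proj X S n x) q"
    using pq
  proof (cases rule: Tot_df_cases)
    case 1
    then show ?thesis
      using x Tot_mem[of x n 0] Tot_proj_apply[of n 0 x] unfolding c
      by (simp add: Tot_df_0 Y.Tot_df_0 Tot_proj_closed dh_cls)
  next
    case (2 p' q')
    have mem: "x (Suc q') \<in> carrier (DOb X p' (Suc q'))" "x q' \<in> carrier (DOb X (Suc p') q')"
      using x Tot_mem_mid[of x p' q'] 2 by simp_all
    have app: "Tot_proj X S n x (Suc q') = cls p' (Suc q') (x (Suc q'))"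
      "Tot_proj X S n x q' = cls (Suc p') q' (x q')"
      using Tot_proj_apply[of p' "Suc q'" x] Tot_proj_apply[of "Suc p'" q' x] 2 by simp_all
    show ?thesis
      unfolding c unfolding 2(1,2) using mem app unfolding 2(3) Tot_df_mid Y.Tot_df_mid
      by (simp add: hom_mult[OF cls_hom] dh_closed dv_closed dh_cls dv_cls
          hom_int_pow[OF cls_hom] group_DOb group_DOb_Y del: add_Suc_right)
  next
    case 3
    then show ?thesis
      using x Tot_mem[of x 0 n] Tot_proj_apply[of 0 n x] unfolding c
      by (simp add: Tot_df_top Y.Tot_df_top Tot_proj_closed dv_cls)
  qed
qed

lemma Tot_proj_eq_one_iff:
  assumes x: "x \<in> carrier (Ob (Tot X) n)"
  shows "Tot_proj X S n x = \<one>\<^bsub>Ob (Tot Y) n\<^esub> \<longleftrightarrow> (\<forall>p q. n = p + q \<longrightarrow> x q \<in> carrier (DOb S p q))"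
proof
  assume *: "Tot_proj X S n x = \<one>\<^bsub>Ob (Tot Y) n\<^esub>"
  show "\<forall>p q. n = p + q \<longrightarrow> x q \<in> carrier (DOb S p q)"
  proof (intro allI impI)
    fix p q assume n: "n = p + q"
    then have "cls p q (x q) = \<one>\<^bsub>DOb Y p q\<^esub>"
      using arg_cong[OF *, of "\<lambda>f. f q"] Tot_proj_apply Y.Tot_one by metis
    then show "x q \<in> carrier (DOb S p q)"
      using x n Tot_mem cls_eq_one_iff by blast
  qed
next
  assume *: "\<forall>p q. n = p + q \<longrightarrow> x q \<in> carrier (DOb S p q)"
  show "Tot_proj X S n x = \<one>\<^bsub>Ob (Tot Y) n\<^esub>"
  proof (rule Y.Tot_eqI[OF Tot_proj_closed[OF x]])
    show "\<one>\<^bsub>Ob (Tot Y) n\<^esub> \<in> carrier (Ob (Tot Y) n)"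
      using Y.comm_group_Tot comm_groupE(2) by blast
    fix p q assume n: "n = p + q"
    have "cls p q (x q) = \<one>\<^bsub>DOb Y p q\<^esub>"
      using * n x Tot_mem cls_eq_one_iff by blast
    then show "Tot_proj X S n x q = \<one>\<^bsub>Ob (Tot Y) n\<^esub> q"
      unfolding n by (simp only: Tot_proj_apply Y.Tot_one)
  qed
qed

end

section \<open>Alternating products\<close>

text \<open>An alternating sum of \<open>n + 1\<close> terms, written multiplicatively: signs become
  integer exponents.\<close>

definition alt_prod :: "nat \<Rightarrow> (nat \<Rightarrow> 'a::field) \<Rightarrow> 'a" where
  "alt_prod n f = (\<Prod>i\<le>n. f i powi ((-1) ^ i))"

lemma alt_prod_cong: "(\<And>i. i \<le> n \<Longrightarrow> f i = g i) \<Longrightarrow> alt_prod n f = alt_prod n g"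
  unfolding alt_prod_def by (rule prod.cong) auto

lemma alt_prod_mult: "alt_prod n (\<lambda>i. f i * g i) = alt_prod n f * alt_prod n g"
  by (simp add: alt_prod_def power_int_mult_distrib prod.distrib)

lemma alt_prod_one [simp]: "alt_prod n (\<lambda>i. 1) = 1"
  by (simp add: alt_prod_def)

lemma prod_powi: "(\<Prod>i\<in>I. f i powi k) = (\<Prod>i\<in>I. f i :: 'a::field) powi k"
  by (induction I rule: infinite_finite_induct) (simp_all add: power_int_mult_distrib)

text \<open>Iterated exponents multiply, and the product of the two signs is symmetric. This is why
  the two differentials of cochains commute.\<close>

lemma alt_prod_swap: "alt_prod m (\<lambda>i. alt_prod n (f i)) = alt_prod n (\<lambda>j. alt_prod m (\<lambda>i. f i j))"
proof -
  have "alt_prod m (\<lambda>i. alt_prod n (f i)) = (\<Prod>i\<le>m. \<Prod>j\<le>n. (f i j powi ((-1) ^ j)) powi ((-1) ^ i))"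
    by (simp add: alt_prod_def prod_powi)
  also have "\<dots> = (\<Prod>j\<le>n. \<Prod>i\<le>m. (f i j powi ((-1) ^ i)) powi ((-1) ^ j))"
    by (subst prod.swap) (simp add: power_int_mult[symmetric] mult.commute)
  finally show ?thesis
    by (simp add: alt_prod_def prod_powi)
qed

lemma cmod_alt_prod: "(\<And>i. i \<le> n \<Longrightarrow> cmod (f i) = 1) \<Longrightarrow> cmod (alt_prod n f) = 1"
  by (simp add: alt_prod_def norm_power_int flip: prod_norm)

lemma powi_cancel: "(x::'a::field) \<noteq> 0 \<Longrightarrow> x powi ((-1) ^ i) * x powi ((-1) ^ Suc i) = 1"
  by (simp add: power_int_minus)

text \<open>The form in which normalization is used: for a tuple containing the unit, two
  neighbouring faces agree and enter with opposite signs, and all other faces contribute 1.\<close>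

lemma alt_prod_eq_one:
  assumes "k < n" "f k = f (Suc k)" "f k \<noteq> 0"
    and "\<And>i. i \<le> n \<Longrightarrow> i \<noteq> k \<Longrightarrow> i \<noteq> Suc k \<Longrightarrow> f i = 1"
  shows "alt_prod n f = 1"
proof -
  have "alt_prod n f = (\<Prod>i\<in>{k, Suc k}. f i powi ((-1) ^ i))"
    unfolding alt_prod_def using assms by (intro prod.mono_neutral_right) auto
  also have "\<dots> = 1"
    using assms powi_cancel[of "f k" k] by simp
  finally show ?thesis .
qed

text \<open>The cancellation behind \<open>d d = 0\<close> for the alternating sum of faces of a simplicial object.\<close>

lemma alt_prod_alt_prod_cancel:
  fixes f :: "nat \<Rightarrow> nat \<Rightarrow> 'a::field"
  assumes nz: "\<And>i j. f i j \<noteq> 0"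
    and sym: "\<And>i j. i < j \<Longrightarrow> j \<le> Suc n \<Longrightarrow> f i j = f (j - 1) i"
  shows "alt_prod (Suc n) (\<lambda>j. alt_prod n (\<lambda>i. f i j)) = 1"
proof -
  define g where "g = (\<lambda>(j, i). f i j powi ((-1) ^ (i + j)))"
  \<comment> \<open>The index pairs are split according to whether \<open>sym\<close> applies:
    \<open>i < j\<close> in \<open>S\<close>, and \<open>j \<le> i\<close> in
    \<open>T\<close>.\<close>
  define S where "S = {(j, i). j \<le> Suc n \<and> i \<le> n \<and> i < j}"
  define T where "T = {(j, i). j \<le> Suc n \<and> i \<le> n \<and> j \<le> i}"
  have fin: "finite S" "finite T"
    by (rule finite_subset[of _ "{..Suc n} \<times> {..n}"]; auto simp: S_def T_def)+
  have "alt_prod (Suc n) (\<lambda>j. alt_prod n (\<lambda>i. f i j)) = (\<Prod>j\<le>Suc n. \<Prod>i\<le>n. g (j, i))"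
    by (simp add: alt_prod_def g_def power_add power_int_mult flip: prod_powi del: prod.atMost_Suc)
  also have "\<dots> = prod g ({..Suc n} \<times> {..n})"
    by (simp add: prod.cartesian_product del: prod.atMost_Suc)
  also have "{..Suc n} \<times> {..n} = S \<union> T"
    by (auto simp: S_def T_def)
  also have "prod g (S \<union> T) = prod g S * prod g T"
    using fin by (rule prod.union_disjoint) (auto simp: S_def T_def)
  \<comment> \<open>The bijection from \<open>T\<close> to \<open>S\<close> that sends
    \<open>(j, i)\<close> to \<open>(Suc i, j)\<close> preserves the value of \<open>f\<close> by
    \<open>sym\<close> and raises the exponent of the sign by one, so it inverts each
    factor.\<close>
  also have "prod g T = prod (\<lambda>x. inverse (g x)) S"
  proof (rule prod.reindex_bij_witness[where i = "\<lambda>(j, i). (i, j - 1)" and j = "\<lambda>(j, i). (Suc i, j)"])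
    fix x assume "x \<in> T"
    then obtain j i where x: "x = (j, i)" "j \<le> i" "i \<le> n"
      by (auto simp: T_def)
    then have "f j (Suc i) = f i j"
      using sym[of j "Suc i"] by simp
    then show "inverse (g (case x of (j, i) \<Rightarrow> (Suc i, j))) = g x"
      by (simp add: x g_def power_int_minus add.commute)
  qed (auto simp: S_def T_def)
  also have "prod g S * prod (\<lambda>x. inverse (g x)) S = (\<Prod>x\<in>S. g x * inverse (g x))"
    by (simp add: prod.distrib)
  also have "\<dots> = 1"
    using nz by (intro prod.neutral) (auto simp: g_def)
  finally show ?thesis .
qed

section \<open>Faces of tuples\<close>

text \<open>The faces of the bar construction: the indices 0 and \<open>length xs\<close> give the
  outer factors of a differential, those in between the factors with \<open>merge\<close>.\<close>

definition face :: "('a, 'b) monoid_scheme \<Rightarrow> nat \<Rightarrow> 'a list \<Rightarrow> 'a list" where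
  "face M i xs = (if i = 0 then tl xs else if i = length xs then butlast xs else merge M i xs)"

lemma length_face: "length xs = Suc n \<Longrightarrow> i \<le> Suc n \<Longrightarrow> length (face M i xs) = n"
  by (auto simp: face_def merge_def)

text \<open>Entrywise access turns identities between faces into case distinctions on indices. The
  outer faces fit the same formula: for \<open>i = 0\<close> only its last case occurs, for
  \<open>i = Suc n\<close> only its first.\<close>

lemma nth_face:
  assumes "length xs = Suc n" "i \<le> Suc n" "k < n"
  shows "face M i xs ! k =
    (if Suc k < i then xs ! k else if Suc k = i then xs ! k \<otimes>\<^bsub>M\<^esub> xs ! i else xs ! Suc k)"
proof -
  have "merge M i xs ! k =
      (if Suc k < i then xs ! k else if Suc k = i then xs ! k \<otimes>\<^bsub>M\<^esub> xs ! i else xs ! Suc k)"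
    if "0 < i" "i < Suc n"
  proof -
    consider "Suc k < i" | "Suc k = i" | d where "k = i + d"
      by (metis less_Suc_eq_le less_iff_Suc_add linorder_neqE_nat add_Suc_right add_0_right le_Suc_ex)
    then show ?thesis
      using that assms by cases (auto simp: merge_def nth_append min_def nth_Cons')
  qed
  then show ?thesis
    using assms by (auto simp: face_def nth_tl nth_butlast)
qed

lemma tuples_iff_nth:
  "xs \<in> tuples M n \<longleftrightarrow> length xs = n \<and> (\<forall>k<n. xs ! k \<in> carrier M)"
  by (auto simp: tuples_def set_conv_nth)

lemma face_map:
  assumes "ks \<in> tuples K (Suc n)" "i \<le> Suc n"
    and "\<And>x y. x \<in> carrier K \<Longrightarrow> y \<in> carrier K \<Longrightarrow> h (x \<otimes>\<^bsub>K\<^esub> y) = h x \<otimes>\<^bsub>L\<^esub> h y"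
  shows "face L i (map h ks) = map h (face K i ks)"
proof (rule nth_equalityI)
  have len: "length ks = Suc n" and cl: "\<And>k. k < Suc n \<Longrightarrow> ks ! k \<in> carrier K"
    using assms(1) by (auto simp: tuples_iff_nth)
  show "length (face L i (map h ks)) = length (map h (face K i ks))"
    using len assms(2) by (simp add: length_face)
  fix k assume "k < length (face L i (map h ks))"
  then have k: "k < n"
    using len assms(2) by (simp add: length_face)
  then have "ks ! k \<in> carrier K" "ks ! Suc k \<in> carrier K"
    using cl by auto
  from assms(3)[OF this] show "face L i (map h ks) ! k = map h (face K i ks) ! k"
    using k len assms(2) by (auto simp: nth_face[of _ n] length_face)
qed

context monoid
begin

lemma face_tuples: "xs \<in> tuples G (Suc n) \<Longrightarrow> i \<le> Suc n \<Longrightarrow> face G i xs \<in> tuples G n"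
  by (auto simp: tuples_iff_nth length_face nth_face)

text \<open>The simplicial identity of the bar construction. Associativity enters for
  \<open>j = Suc i\<close>, where three neighbouring entries may be multiplied.\<close>

lemma face_face:
  assumes xs: "xs \<in> tuples G (Suc (Suc n))" and ij: "i < j" "j \<le> Suc (Suc n)"
  shows "face G i (face G j xs) = face G (j - 1) (face G i xs)"
proof (rule nth_equalityI)
  have len: "length xs = Suc (Suc n)"
    and cl: "\<And>k. k < Suc (Suc n) \<Longrightarrow> xs ! k \<in> carrier G"
    using xs by (auto simp: tuples_iff_nth)
  show "length (face G i (face G j xs)) = length (face G (j - 1) (face G i xs))"
    using len ij by (simp add: length_face)
  fix k assume "k < length (face G i (face G j xs))"
  then have "k < n"
    using len ij by (simp add: length_face)
  then show "face G i (face G j xs) ! k = face G (j - 1) (face G i xs) ! k"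
    using len ij cl
    by (auto simp: nth_face[of _ n] nth_face[of _ "Suc n"] length_face m_assoc)
qed

text \<open>The unit at position \<open>m\<close>, counted from 0, is absorbed by its left neighbour
  in one face and by its right neighbour in the other; at an end of the tuple it is dropped.\<close>

lemma face_one_eq:
  assumes "xs \<in> tuples G (Suc n)" "m < Suc n" "xs ! m = \<one>"
  shows "face G m xs = face G (Suc m) xs"
proof (rule nth_equalityI)
  fix k assume "k < length (face G m xs)"
  then have "k < n" using assms by (simp add: length_face tuples_iff_nth)
  then show "face G m xs ! k = face G (Suc m) xs ! k"
    using assms by (auto simp: tuples_iff_nth nth_face[of _ n])
qed (use assms in \<open>simp add: length_face tuples_iff_nth\<close>)

lemma one_in_face:
  assumes "xs \<in> tuples G (Suc n)" "m < Suc n" "xs ! m = \<one>" "i \<le> Suc n" "i \<noteq> m" "i \<noteq> Suc m"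
  shows "\<one> \<in> set (face G i xs)"
proof -
  \<comment> \<open>The position of the unit after the face: a face to its left shifts it down by
    one, a face to its right leaves it in place.\<close>
  define k where "k = (if i < m then m - 1 else m)"
  have "k < n" "face G i xs ! k = \<one>"
    using assms by (auto simp: k_def tuples_iff_nth nth_face[of _ n])
  then show ?thesis
    using assms by (metis length_face nth_mem tuples_iff_nth)
qed

end

section \<open>The double complex of circle-valued cochains\<close>

text \<open>The default value 1 has norm 1, so the norm condition extends to all lists; cochains are
  then nowhere zero.\<close>

lemma cochains_iff:
  "F \<in> carrier (cochains G K p q) \<longleftrightarrow>
     (\<forall>gs ks. cmod (F gs ks) = 1) \<and>
     (\<forall>gs ks. \<not> (gs \<in> tuples G p \<and> ks \<in> tuples K q) \<longrightarrow> F gs ks = 1) \<and>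
     (\<forall>gs ks. \<one>\<^bsub>G\<^esub> \<in> set gs \<or> \<one>\<^bsub>K\<^esub> \<in> set ks \<longrightarrow> F gs ks = 1)"
proof -
  have "cmod (F gs ks) = 1"
    if "\<forall>gs\<in>tuples G p. \<forall>ks\<in>tuples K q. cmod (F gs ks) = 1"
      "\<forall>gs ks. \<not> (gs \<in> tuples G p \<and> ks \<in> tuples K q) \<longrightarrow> F gs ks = 1" for gs ks
    using that by (cases "gs \<in> tuples G p \<and> ks \<in> tuples K q") auto
  then show ?thesis
    unfolding cochains_def by auto
qed

lemma mult_cochains [simp]: "(F \<otimes>\<^bsub>cochains G K p q\<^esub> F') = (\<lambda>gs ks. F gs ks * F' gs ks)"
  by (simp add: cochains_def)

lemma one_cochains [simp]: "\<one>\<^bsub>cochains G K p q\<^esub> = (\<lambda>gs ks. 1)"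
  by (simp add: cochains_def)

lemma comm_group_cochains: "comm_group (cochains G K p q)"
proof (rule comm_groupI)
  fix F assume F: "F \<in> carrier (cochains G K p q)"
  then have "F gs ks \<noteq> 0" for gs ks
    unfolding cochains_iff by (metis norm_zero zero_neq_one)
  with F show "\<exists>F'\<in>carrier (cochains G K p q). F' \<otimes>\<^bsub>cochains G K p q\<^esub> F = \<one>\<^bsub>cochains G K p q\<^esub>"
    by (intro bexI[of _ "\<lambda>gs ks. inverse (F gs ks)"]) (simp_all add: cochains_iff norm_inverse)
qed (auto simp: cochains_iff norm_mult mult.assoc mult.commute mult.left_commute)

lemma cochain_nonzero: "F \<in> carrier (cochains G K p q) \<Longrightarrow> F gs ks \<noteq> 0"
  unfolding cochains_iff by (metis norm_zero zero_neq_one)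

lemma atMost_Suc_split: "{..Suc n} = insert 0 (insert (Suc n) {1..n})"
  by auto

text \<open>The first and the last factor of the definition are the faces 0 and
  \<open>Suc q\<close>, so the differential is one alternating product over all faces.\<close>

lemma delta_K_eq:
  "delta_K G K p q F gs ks =
    (if gs \<in> tuples G p \<and> ks \<in> tuples K (Suc q) then alt_prod (Suc q) (\<lambda>j. F gs (face K j ks)) else 1)"
proof (cases "gs \<in> tuples G p \<and> ks \<in> tuples K (Suc q)")
  case True
  then have "length ks = Suc q"
    by (simp add: tuples_def)
  then have "alt_prod (Suc q) (\<lambda>j. F gs (face K j ks))
      = F gs (tl ks) * (F gs (butlast ks) powi ((-1) ^ (q + 1))
        * (\<Prod>j = 1..q. F gs (merge K j ks) powi ((-1) ^ j)))"
    unfolding alt_prod_def atMost_Suc_split by (simp add: face_def)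
  then show ?thesis
    using True by (simp add: delta_K_def)
qed (auto simp: delta_K_def)

locale equivariant_monoid = G: group G + K: monoid K
  for G :: "('g, 'a) monoid_scheme" (structure) and K :: "('k, 'b) monoid_scheme" (structure) +
  fixes act :: "'g \<Rightarrow> 'k \<Rightarrow> 'k"
  assumes act_hom: "act \<in> hom G (AutoGroup K)"
begin

abbreviation C where "C \<equiv> cochains G K"
abbreviation \<delta>G where "\<delta>G \<equiv> delta_G G K act"
abbreviation \<delta>K where "\<delta>K \<equiv> delta_K G K"

section \<open>Elementary properties of the action\<close>

lemma act_auto: "g \<in> carrier G \<Longrightarrow> act g \<in> hom K K \<and> act g \<in> Bij (carrier K)"
  using hom_in_carrier[OF act_hom] by (simp add: AutoGroup_def auto_def)

lemma act_closed: "g \<in> carrier G \<Longrightarrow> k \<in> carrier K \<Longrightarrow> act g k \<in> carrier K"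
  by (rule hom_in_carrier[OF conjunct1[OF act_auto]])

lemma act_mult:
  "g \<in> carrier G \<Longrightarrow> k \<in> carrier K \<Longrightarrow> l \<in> carrier K \<Longrightarrow> act g (k \<otimes>\<^bsub>K\<^esub> l) = act g k \<otimes>\<^bsub>K\<^esub> act g l"
  by (rule hom_mult[OF conjunct1[OF act_auto]])

lemma act_act:
  assumes "g \<in> carrier G" "h \<in> carrier G" "k \<in> carrier K"
  shows "act (g \<otimes>\<^bsub>G\<^esub> h) k = act g (act h k)"
proof -
  have "act (g \<otimes>\<^bsub>G\<^esub> h) = act g \<otimes>\<^bsub>AutoGroup K\<^esub> act h"
    by (rule hom_mult[OF act_hom assms(1,2)])
  also have "\<dots> = compose (carrier K) (act g) (act h)"
    using act_auto[OF assms(1)] act_auto[OF assms(2)] by (simp add: AutoGroup_def BijGroup_def)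
  finally show ?thesis
    using assms(3) by (simp add: compose_eq)
qed

lemma act_surj:
  assumes "g \<in> carrier G" shows "act g ` carrier K = carrier K"
  using act_auto[OF assms] by (simp add: Bij_def bij_betw_def)

text \<open>Surjectivity gives an \<open>l\<close> that the unit of \<open>G\<close> maps to
  \<open>k\<close>; as the unit is idempotent, acting once more changes nothing.\<close>

lemma act_one_left:
  assumes k: "k \<in> carrier K" shows "act \<one>\<^bsub>G\<^esub> k = k"
proof -
  obtain l where l: "l \<in> carrier K" "k = act \<one>\<^bsub>G\<^esub> l"
    using act_surj[OF G.one_closed] k by blast
  then show ?thesis
    using act_act[OF G.one_closed G.one_closed l(1)] by simp
qed

text \<open>A surjective multiplicative map preserves the unit.\<close>

lemma act_one_right:
  assumes g: "g \<in> carrier G" shows "act g \<one>\<^bsub>K\<^esub> = \<one>\<^bsub>K\<^esub>"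
proof -
  have "\<one>\<^bsub>K\<^esub> \<in> act g ` carrier K"
    by (simp add: act_surj[OF g])
  then obtain l where l: "l \<in> carrier K" "act g l = \<one>\<^bsub>K\<^esub>"
    by (metis imageE)
  have "act g \<one>\<^bsub>K\<^esub> = act g l \<otimes>\<^bsub>K\<^esub> act g \<one>\<^bsub>K\<^esub>"
    using l g act_closed by simp
  also have "\<dots> = \<one>\<^bsub>K\<^esub>"
    using act_mult[OF g l(1) K.one_closed] l by simp
  finally show ?thesis .
qed

text \<open>The companion of \<open>face G i\<close> on the tuple from \<open>K\<close>: only the
  last face of \<open>gs\<close> lets the group element that it removes act.\<close>

definition twist :: "nat \<Rightarrow> 'g list \<Rightarrow> 'k list \<Rightarrow> 'k list" where
  "twist i gs ks = (if i = length gs then map (act (last gs)) ks else ks)"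

lemma last_tuples: "gs \<in> tuples G (Suc p) \<Longrightarrow> last gs \<in> carrier G"
  by (cases gs rule: rev_cases) (auto simp: tuples_def)

lemma map_act_tuples: "g \<in> carrier G \<Longrightarrow> ks \<in> tuples K q \<Longrightarrow> map (act g) ks \<in> tuples K q"
  by (auto simp: tuples_def act_closed)

lemma twist_tuples: "gs \<in> tuples G (Suc p) \<Longrightarrow> ks \<in> tuples K q \<Longrightarrow> twist i gs ks \<in> tuples K q"
  by (simp add: twist_def map_act_tuples last_tuples)

lemma one_in_twist: "gs \<in> tuples G (Suc p) \<Longrightarrow> \<one>\<^bsub>K\<^esub> \<in> set ks \<Longrightarrow> \<one>\<^bsub>K\<^esub> \<in> set (twist i gs ks)"
  using act_one_right[OF last_tuples, of gs p] by (auto simp: twist_def intro: rev_image_eqI)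

lemma face_twist:
  assumes "gs \<in> tuples G (Suc p)" "ks \<in> tuples K (Suc q)" "j \<le> Suc q"
  shows "face K j (twist i gs ks) = twist i gs (face K j ks)"
  using face_map[where L = K, OF assms(2,3) act_mult[OF last_tuples[OF assms(1)]]]
  by (simp add: twist_def)

lemma last_face:
  assumes "gs \<in> tuples G (Suc (Suc p))" "i \<le> Suc (Suc p)"
  shows "last (face G i gs) = (if i = Suc p then gs ! p \<otimes>\<^bsub>G\<^esub> gs ! Suc p
    else if i = Suc (Suc p) then gs ! p else gs ! Suc p)"
proof -
  have "length (face G i gs) = Suc p"
    using assms by (simp add: tuples_iff_nth length_face)
  then have "last (face G i gs) = face G i gs ! p"
    by (metis Zero_not_Suc diff_Suc_1 last_conv_nth list.size(3))
  then show ?thesis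
    using assms by (auto simp: tuples_iff_nth nth_face[of _ "Suc p"])
qed

text \<open>The simplicial identity for the arguments from \<open>K\<close>. For
  \<open>i = Suc p\<close> and \<open>j = Suc (Suc p)\<close> it is \<open>act_act\<close>: acting
  by the last two entries in turn is acting by their product.\<close>

lemma twist_twist:
  assumes gs: "gs \<in> tuples G (Suc (Suc p))" and ks: "ks \<in> tuples K q" and ij: "i < j" "j \<le> Suc (Suc p)"
  shows "twist i (face G j gs) (twist j gs ks) = twist (j - 1) (face G i gs) (twist i gs ks)"
proof -
  have len: "length gs = Suc (Suc p)" and cl: "gs ! p \<in> carrier G" "gs ! Suc p \<in> carrier G"
    using gs by (auto simp: tuples_iff_nth)
  have last: "last gs = gs ! Suc p"
    using len by (metis Zero_not_Suc diff_Suc_1 last_conv_nth list.size(3))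
  have k: "k \<in> set ks \<Longrightarrow> k \<in> carrier K" for k
    using ks by (auto simp: tuples_def)
  show ?thesis
    using ij len last cl k gs
    by (auto simp: twist_def length_face last_face act_act)
qed

lemma delta_G_eq:
  "\<delta>G p q F gs ks =
    (if gs \<in> tuples G (Suc p) \<and> ks \<in> tuples K q
     then alt_prod (Suc p) (\<lambda>i. F (face G i gs) (twist i gs ks)) else 1)"
proof (cases "gs \<in> tuples G (Suc p) \<and> ks \<in> tuples K q")
  case True
  then have "length gs = Suc p"
    by (simp add: tuples_def)
  then have "alt_prod (Suc p) (\<lambda>i. F (face G i gs) (twist i gs ks))
      = F (tl gs) ks * (F (butlast gs) (map (act (last gs)) ks) powi ((-1) ^ (p + 1))
        * (\<Prod>i = 1..p. F (merge G i gs) ks powi ((-1) ^ i)))"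
    unfolding alt_prod_def atMost_Suc_split by (simp add: face_def twist_def)
  then show ?thesis
    using True by (simp add: delta_G_def)
qed (auto simp: delta_G_def)

text \<open>The point is normalization: if \<open>ks\<close> contains the unit,
  \<open>alt_prod_eq_one\<close> applies to the two faces that absorb it.\<close>

lemma delta_K_closed:
  assumes F: "F \<in> carrier (C p q)" shows "\<delta>K p q F \<in> carrier (C p (Suc q))"
proof -
  have "alt_prod (Suc q) (\<lambda>j. F gs (face K j ks)) = 1"
    if ks: "ks \<in> tuples K (Suc q)" and one: "\<one>\<^bsub>G\<^esub> \<in> set gs \<or> \<one>\<^bsub>K\<^esub> \<in> set ks" for gs ks
  proof (cases "\<one>\<^bsub>K\<^esub> \<in> set ks")
    case True
    then obtain m where m: "m < Suc q" "ks ! m = \<one>\<^bsub>K\<^esub>"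
      using ks by (auto simp: tuples_iff_nth in_set_conv_nth)
    show ?thesis
      using m ks F K.one_in_face[OF ks m] K.face_one_eq[OF ks m]
      by (intro alt_prod_eq_one[of m]) (auto simp: cochain_nonzero[OF F] cochains_iff)
  next
    case False
    then show ?thesis
      using one F by (simp add: cochains_iff)
  qed
  then show ?thesis
    using F by (auto simp: cochains_iff delta_K_eq cmod_alt_prod)
qed

lemma delta_G_closed:
  assumes F: "F \<in> carrier (C p q)" shows "\<delta>G p q F \<in> carrier (C (Suc p) q)"
proof -
  have "alt_prod (Suc p) (\<lambda>i. F (face G i gs) (twist i gs ks)) = 1"
    if gs: "gs \<in> tuples G (Suc p)" and ks: "ks \<in> tuples K q"
      and one: "\<one>\<^bsub>G\<^esub> \<in> set gs \<or> \<one>\<^bsub>K\<^esub> \<in> set ks" for gs ks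
  proof (cases "\<one>\<^bsub>K\<^esub> \<in> set ks")
    case True
    then show ?thesis
      using F one_in_twist[OF gs] by (simp add: cochains_iff)
  next
    case False
    then obtain m where m: "m < Suc p" "gs ! m = \<one>\<^bsub>G\<^esub>"
      using gs one by (auto simp: tuples_iff_nth in_set_conv_nth)
    have len: "length gs = Suc p"
      using gs by (simp add: tuples_iff_nth)
    \<comment> \<open>The two cancelling faces must also agree in the arguments from
      \<open>K\<close>. If the unit is the last entry of \<open>gs\<close>, one of them is twisted,
      but by the trivial action.\<close>
    have "twist m gs ks = twist (Suc m) gs ks"
    proof (cases "m = p")
      case True
      then have "last gs = \<one>\<^bsub>G\<^esub>"
        using m len by (metis diff_Suc_1 last_conv_nth length_0_conv nat.simps(3))
      moreover have "map (act \<one>\<^bsub>G\<^esub>) ks = ks"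
        using ks by (auto simp: tuples_def act_one_left subset_iff intro!: map_idI)
      ultimately show ?thesis
        using True len by (simp add: twist_def)
    qed (use m len in \<open>simp add: twist_def\<close>)
    then show ?thesis
      using m F G.one_in_face[OF gs m] G.face_one_eq[OF gs m]
      by (intro alt_prod_eq_one[of m]) (auto simp: cochain_nonzero[OF F] cochains_iff)
  qed
  then show ?thesis
    using F by (auto simp: cochains_iff delta_G_eq cmod_alt_prod)
qed

lemma delta_K_hom: "\<delta>K p q \<in> hom (C p q) (C p (Suc q))"
  by (rule homI) (auto simp: delta_K_closed delta_K_eq alt_prod_mult fun_eq_iff)

lemma delta_G_hom: "\<delta>G p q \<in> hom (C p q) (C (Suc p) q)"
  by (rule homI) (auto simp: delta_G_closed delta_G_eq alt_prod_mult fun_eq_iff)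

lemma delta_K_delta_K:
  assumes F: "F \<in> carrier (C p q)" shows "\<delta>K p (Suc q) (\<delta>K p q F) = (\<lambda>gs ks. 1)"
proof -
  have "alt_prod (Suc (Suc q)) (\<lambda>j. \<delta>K p q F gs (face K j ks)) = 1"
    if gs: "gs \<in> tuples G p" and ks: "ks \<in> tuples K (Suc (Suc q))" for gs ks
  proof -
    have "alt_prod (Suc (Suc q)) (\<lambda>j. \<delta>K p q F gs (face K j ks))
        = alt_prod (Suc (Suc q)) (\<lambda>j. alt_prod (Suc q) (\<lambda>i. F gs (face K i (face K j ks))))"
      using gs ks by (intro alt_prod_cong) (simp add: delta_K_eq K.face_tuples)
    also have "\<dots> = 1"
      using ks K.face_face by (intro alt_prod_alt_prod_cancel) (auto simp: cochain_nonzero[OF F])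
    finally show ?thesis .
  qed
  then show ?thesis
    by (auto simp: fun_eq_iff delta_K_eq[of _ _ _ "Suc q"])
qed

lemma delta_G_delta_G:
  assumes F: "F \<in> carrier (C p q)" shows "\<delta>G (Suc p) q (\<delta>G p q F) = (\<lambda>gs ks. 1)"
proof -
  have "alt_prod (Suc (Suc p)) (\<lambda>j. \<delta>G p q F (face G j gs) (twist j gs ks)) = 1"
    if gs: "gs \<in> tuples G (Suc (Suc p))" and ks: "ks \<in> tuples K q" for gs ks
  proof -
    have "alt_prod (Suc (Suc p)) (\<lambda>j. \<delta>G p q F (face G j gs) (twist j gs ks))
        = alt_prod (Suc (Suc p)) (\<lambda>j. alt_prod (Suc p)
            (\<lambda>i. F (face G i (face G j gs)) (twist i (face G j gs) (twist j gs ks))))"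
      using gs ks by (intro alt_prod_cong) (simp add: delta_G_eq G.face_tuples twist_tuples)
    also have "\<dots> = 1"
      using gs ks G.face_face twist_twist
      by (intro alt_prod_alt_prod_cancel) (auto simp: cochain_nonzero[OF F])
    finally show ?thesis .
  qed
  then show ?thesis
    by (auto simp: fun_eq_iff delta_G_eq[of "Suc p"])
qed

text \<open>Both sides are the same double alternating product in different order;
  \<open>face_twist\<close> makes the arguments agree.\<close>

lemma delta_G_delta_K: "\<delta>G p (Suc q) (\<delta>K p q F) = \<delta>K (Suc p) q (\<delta>G p q F)"
proof (intro ext)
  fix gs ks
  show "\<delta>G p (Suc q) (\<delta>K p q F) gs ks = \<delta>K (Suc p) q (\<delta>G p q F) gs ks"
  proof (cases "gs \<in> tuples G (Suc p) \<and> ks \<in> tuples K (Suc q)")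
    case True
    then have gs: "gs \<in> tuples G (Suc p)" and ks: "ks \<in> tuples K (Suc q)"
      by auto
    have "\<delta>G p (Suc q) (\<delta>K p q F) gs ks
        = alt_prod (Suc p) (\<lambda>i. alt_prod (Suc q) (\<lambda>j. F (face G i gs) (twist i gs (face K j ks))))"
      using gs ks
      by (simp add: delta_G_eq) (intro alt_prod_cong,
        simp add: delta_K_eq G.face_tuples twist_tuples face_twist cong: alt_prod_cong)
    also have "\<dots> = alt_prod (Suc q) (\<lambda>j. alt_prod (Suc p) (\<lambda>i. F (face G i gs) (twist i gs (face K j ks))))"
      by (rule alt_prod_swap)
    also have "\<dots> = \<delta>K (Suc p) q (\<delta>G p q F) gs ks"
      using gs ks
      by (simp add: delta_K_eq) (intro alt_prod_cong, simp add: delta_G_eq K.face_tuples)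
    finally show ?thesis .
  qed (auto simp: delta_G_eq delta_K_eq)
qed

lemma group_cochains: "group (C p q)"
  using comm_group_cochains comm_group.axioms(2) by blast

lemma delta_K_one: "\<delta>K p q (\<lambda>gs ks. 1) = (\<lambda>gs ks. 1)"
  by (auto simp: delta_K_eq fun_eq_iff)

lemma delta_G_one: "\<delta>G p q (\<lambda>gs ks. 1) = (\<lambda>gs ks. 1)"
  by (auto simp: delta_G_eq fun_eq_iff)

lemma one_in_cochains: "(\<lambda>gs ks. 1) \<in> carrier (C p q)"
  by (simp add: cochains_iff)

section \<open>The double complexes \<open>A_gt\<close> and the complex of invariant
  cochains\<close>

lemma carrier_A_gt:
  "carrier (DOb (A_gt G K act r) p q) = (if r < q then carrier (C p q) else {\<lambda>gs ks. 1})"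
  by (simp add: A_gt_def)

lemma mult_A_gt: "x \<otimes>\<^bsub>DOb (A_gt G K act r) p q\<^esub> y = (\<lambda>gs ks. x gs ks * y gs ks)"
  by (simp add: A_gt_def)

lemma one_A_gt: "\<one>\<^bsub>DOb (A_gt G K act r) p q\<^esub> = (\<lambda>gs ks. 1)"
  by (simp add: A_gt_def)

lemma dh_A_gt: "dh (A_gt G K act r) = \<delta>G" and dv_A_gt: "dv (A_gt G K act r) = \<delta>K"
  by (simp_all add: A_gt_def)

lemma A_gt_subset: "carrier (DOb (A_gt G K act r) p q) \<subseteq> carrier (C p q)"
  by (simp add: carrier_A_gt one_in_cochains)

lemma double_complex_A_gt: "double_complex (A_gt G K act r)"
proof (rule double_complex.intro)
  fix p q
  have "comm_group ((C p q)\<lparr>carrier := {\<one>\<^bsub>C p q\<^esub>}\<rparr>)"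
    by (rule comm_group.comm_group_subgroup[OF comm_group_cochains group.triv_subgroup[OF group_cochains]])
  then show "comm_group (DOb (A_gt G K act r) p q)"
    by (simp add: A_gt_def comm_group_cochains)
  show "dh (A_gt G K act r) p q \<in> hom (DOb (A_gt G K act r) p q) (DOb (A_gt G K act r) (Suc p) q)"
    using hom_mult[OF delta_G_hom] A_gt_subset
    by (intro homI) (auto simp: carrier_A_gt mult_A_gt dh_A_gt delta_G_closed delta_G_one
        split: if_splits)
  show "dv (A_gt G K act r) p q \<in> hom (DOb (A_gt G K act r) p q) (DOb (A_gt G K act r) p (Suc q))"
    using hom_mult[OF delta_K_hom] A_gt_subset
    by (intro homI) (auto simp: carrier_A_gt mult_A_gt dv_A_gt delta_K_closed delta_K_one one_in_cochains
        split: if_splits)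
  fix x assume "x \<in> carrier (DOb (A_gt G K act r) p q)"
  then have "x \<in> carrier (C p q)"
    using A_gt_subset by blast
  then show "dh (A_gt G K act r) (Suc p) q (dh (A_gt G K act r) p q x)
      = \<one>\<^bsub>DOb (A_gt G K act r) (Suc (Suc p)) q\<^esub>"
    "dv (A_gt G K act r) p (Suc q) (dv (A_gt G K act r) p q x)
      = \<one>\<^bsub>DOb (A_gt G K act r) p (Suc (Suc q))\<^esub>"
    "dh (A_gt G K act r) p (Suc q) (dv (A_gt G K act r) p q x)
      = dv (A_gt G K act r) (Suc p) q (dh (A_gt G K act r) p q x)"
    by (simp_all add: dh_A_gt dv_A_gt one_A_gt delta_G_delta_G delta_K_delta_K delta_G_delta_K)
qed

text \<open>The rows \<open>q > s\<close> are preserved since the horizontal differential keeps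
  \<open>q\<close> and the vertical one raises it.\<close>

lemma sub_double_complex_A_gt:
  assumes "r \<le> s" shows "sub_double_complex (A_gt G K act r) (A_gt G K act s)"
proof (intro sub_double_complex.intro double_complex_A_gt sub_double_complex_axioms.intro)
  fix p q
  interpret R: double_complex "A_gt G K act r" by (rule double_complex_A_gt)
  show "subgroup (carrier (DOb (A_gt G K act s) p q)) (DOb (A_gt G K act r) p q)"
    using assms group.subgroup_self[OF R.group_DOb, of p q] group.triv_subgroup[OF R.group_DOb, of p q]
    by (auto simp: carrier_A_gt one_A_gt)
  show "dh (A_gt G K act r) p q ` carrier (DOb (A_gt G K act s) p q) \<subseteq> carrier (DOb (A_gt G K act s) (Suc p) q)"
    by (auto simp: dh_A_gt carrier_A_gt delta_G_closed delta_G_one)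
  show "dv (A_gt G K act r) p q ` carrier (DOb (A_gt G K act s) p q) \<subseteq> carrier (DOb (A_gt G K act s) p (Suc q))"
    by (auto simp: dv_A_gt carrier_A_gt delta_K_closed delta_K_one one_in_cochains)
qed

text \<open>In horizontal degree 0 the differential at \<open>[g]\<close> is the quotient of
  \<open>F [] ks\<close> by the value of \<open>F\<close> at the translate of \<open>ks\<close>, so
  invariance means being closed.\<close>

lemma carrier_inv_cplx:
  "carrier (Ob (inv_cplx G K act) q) = {F \<in> carrier (C 0 q). \<delta>G 0 q F = (\<lambda>gs ks. 1)}"
proof -
  have "\<delta>G 0 q F = (\<lambda>gs ks. 1) \<longleftrightarrow> (\<forall>g\<in>carrier G. \<forall>ks\<in>tuples K q. F [] (map (act g) ks) = F [] ks)"
    if F: "F \<in> carrier (C 0 q)" for F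
  proof -
    have eq: "F [] ks * inverse (F [] ls) = 1 \<longleftrightarrow> F [] ls = F [] ks" for ks ls
      using right_inverse_eq[OF cochain_nonzero[OF F], of "F [] ks" "[]" ls]
      by (auto simp: divide_inverse)
    have "\<delta>G 0 q F = (\<lambda>gs ks. 1)
        \<longleftrightarrow> (\<forall>gs\<in>tuples G (Suc 0). \<forall>ks\<in>tuples K q. F [] ks * inverse (F [] (map (act (last gs)) ks)) = 1)"
      by (force simp: fun_eq_iff delta_G_def tuples_def length_Suc_conv)
    also have "\<dots> \<longleftrightarrow> (\<forall>g\<in>carrier G. \<forall>ks\<in>tuples K q. F [] ks * inverse (F [] (map (act g) ks)) = 1)"
      by (force simp: tuples_def length_Suc_conv)
    finally show ?thesis
      by (simp only: eq)
  qed
  then show ?thesis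
    by (auto simp: inv_cplx_def)
qed

lemma cochain_complex_inv: "cochain_complex (inv_cplx G K act)"
proof (rule cochain_complex.intro)
  fix n
  have "group_hom (C 0 n) (C 1 n) (\<delta>G 0 n)"
    using delta_G_hom[of 0 n] by (simp add: group_cochains group_hom.intro group_hom_axioms.intro)
  then have "subgroup (carrier (Ob (inv_cplx G K act) n)) (C 0 n)"
    using group_hom.subgroup_kernel by (fastforce simp: kernel_def carrier_inv_cplx)
  moreover have Ob: "Ob (inv_cplx G K act) k = (C 0 k)\<lparr>carrier := carrier (Ob (inv_cplx G K act) k)\<rparr>" for k
    by (simp add: inv_cplx_def)
  ultimately show "comm_group (Ob (inv_cplx G K act) n)"
    by (metis comm_group.comm_group_subgroup comm_group_cochains)
  have d: "df (inv_cplx G K act) k = \<delta>K 0 k" for k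
    by (simp add: inv_cplx_def)
  \<comment> \<open>Invariance survives \<open>\<delta>K\<close> because \<open>\<delta>K\<close>
    commutes with \<open>\<delta>G\<close>.\<close>
  have cl: "\<delta>K 0 n F \<in> carrier (Ob (inv_cplx G K act) (Suc n))" if "F \<in> carrier (Ob (inv_cplx G K act) n)" for F
    using that by (auto simp: carrier_inv_cplx delta_K_closed delta_G_delta_K delta_K_one)
  have m: "x \<otimes>\<^bsub>Ob (inv_cplx G K act) k\<^esub> y = x \<otimes>\<^bsub>C 0 k\<^esub> y" for x y k
    by (subst Ob) simp
  show "df (inv_cplx G K act) n \<in> hom (Ob (inv_cplx G K act) n) (Ob (inv_cplx G K act) (Suc n))"
    using cl hom_mult[OF delta_K_hom, of _ 0 n] by (intro homI) (simp_all add: d m carrier_inv_cplx)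
  fix x assume "x \<in> carrier (Ob (inv_cplx G K act) n)"
  then show "df (inv_cplx G K act) (Suc n) (df (inv_cplx G K act) n x) = \<one>\<^bsub>Ob (inv_cplx G K act) (Suc (Suc n))\<^esub>"
    by (subst Ob) (simp add: d carrier_inv_cplx delta_K_delta_K)
qed


section \<open>Invariant cochains inside the total complex\<close>

abbreviation T where "T \<equiv> Tot (A G K act)"
abbreviation I where "I \<equiv> inv_cplx G K act"
abbreviation Tq where "Tq r \<equiv> Tot (quot_dcplx (A G K act) (A_gt G K act r))"
abbreviation proj where "proj r \<equiv> Tot_proj (A G K act) (A_gt G K act r)"

sublocale A: double_complex "A G K act"
  by (rule double_complex_A_gt)

lemma df_inv_cplx: "df I k = \<delta>K 0 k"
  by (simp add: inv_cplx_def)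

lemma mult_inv_cplx: "F \<otimes>\<^bsub>Ob I k\<^esub> F' = (\<lambda>gs ks. F gs ks * F' gs ks)"
  by (simp add: inv_cplx_def)

lemma incl_apply: "incl (p + q) F q = (if p = 0 then F else (\<lambda>gs ks. 1))"
  by (simp add: incl_def)

lemma incl_closed:
  assumes "0 < k" "F \<in> carrier (C 0 k)" shows "incl k F \<in> carrier (Ob T k)"
proof (rule A.Tot_memI)
  fix p q assume "k = p + q"
  then show "incl k F q \<in> carrier (DOb (A G K act) p q)"
    using assms by (auto simp: incl_apply carrier_A_gt one_in_cochains)
qed (simp add: incl_def)

lemma incl_hom:
  assumes k: "0 < k" shows "incl k \<in> hom (Ob I k) (Ob T k)"
proof (rule homI)
  fix F F' assume F: "F \<in> carrier (Ob I k)" "F' \<in> carrier (Ob I k)"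
  have cl: "incl k F \<in> carrier (Ob T k)" "incl k F' \<in> carrier (Ob T k)"
    "incl k (F \<otimes>\<^bsub>Ob I k\<^esub> F') \<in> carrier (Ob T k)"
    using k F cochain_complex.group_Ob[OF cochain_complex_inv] group.is_monoid monoid.m_closed[of "Ob I k" F F']
    by (auto intro!: incl_closed simp: carrier_inv_cplx)
  show "incl k (F \<otimes>\<^bsub>Ob I k\<^esub> F') = incl k F \<otimes>\<^bsub>Ob T k\<^esub> incl k F'"
  proof (rule A.Tot_eqI)
    show "incl k F \<otimes>\<^bsub>Ob T k\<^esub> incl k F' \<in> carrier (Ob T k)"
      using cl A.comm_group_Tot comm_groupE(1) by metis
    fix p q assume "k = p + q"
    then show "incl k (F \<otimes>\<^bsub>Ob I k\<^esub> F') q = (incl k F \<otimes>\<^bsub>Ob T k\<^esub> incl k F') q"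
      by (simp add: A.Tot_mult incl_apply mult_A_gt mult_inv_cplx)
  qed (rule cl)
qed (use k in \<open>auto intro: incl_closed simp: carrier_inv_cplx\<close>)

lemma incl_inj: "inj (incl k)"
  by (rule injI) (metis add_0 incl_apply)

text \<open>Besides the top component only the one in bidegree \<open>(1, k)\<close> could be
  nontrivial. It is \<open>\<delta>G 0 k F\<close>, which is 1 by invariance.\<close>

lemma incl_df:
  assumes k: "0 < k" and F: "F \<in> carrier (Ob I k)"
  shows "incl (Suc k) (\<delta>K 0 k F) = df T k (incl k F)"
proof (rule A.Tot_eqI)
  have FC: "F \<in> carrier (C 0 k)" "\<delta>G 0 k F = (\<lambda>gs ks. 1)"
    using F by (auto simp: carrier_inv_cplx)
  note cl = incl_closed[OF k FC(1)]
  show "incl (Suc k) (\<delta>K 0 k F) \<in> carrier (Ob T (Suc k))"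
    using FC by (simp add: incl_closed delta_K_closed)
  show "df T k (incl k F) \<in> carrier (Ob T (Suc k))"
    using cl by (rule A.Tot_df_closed)
  fix p q assume pq: "Suc k = p + q"
  then show "incl (Suc k) (\<delta>K 0 k F) q = df T k (incl k F) q"
  proof (cases rule: A.Tot_df_cases)
    case 1
    then show ?thesis
      using k cl incl_apply[of k 0 F] incl_apply[of "Suc k" 0]
      by (simp add: A.Tot_df_0 dh_A_gt delta_G_one)
  next
    case (2 p' q')
    have "incl k F (Suc q') = (if p' = 0 then F else (\<lambda>gs ks. 1))" "incl k F q' = (\<lambda>gs ks. 1)"
      using incl_apply[of p' "Suc q'" F] incl_apply[of "Suc p'" q' F] 2 by simp_all
    moreover have "incl (Suc k) (\<delta>K 0 k F) q = (\<lambda>gs ks. 1)"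
      unfolding pq incl_apply using 2 by simp
    moreover have "\<delta>G p' (Suc q') (if p' = 0 then F else (\<lambda>gs ks. 1)) = (\<lambda>gs ks. 1)"
      using FC 2 by (cases p') (simp_all add: delta_G_one)
    moreover have "(\<lambda>gs ks. 1) [^]\<^bsub>DOb (A G K act) p q\<^esub> (i::int) = (\<lambda>gs ks. 1)" for i
      using A.one_int_pow[of p q i] by (simp add: one_A_gt)
    ultimately show ?thesis
      using A.Tot_df_mid[of p' q' "incl k F"] 2
      by (simp add: dh_A_gt dv_A_gt delta_K_one mult_A_gt)
  next
    case 3
    then show ?thesis
      using cl incl_apply[of 0 k F] incl_apply[of 0 "Suc k"] by (simp add: A.Tot_df_top dv_A_gt)
  qed
qed

text \<open>The kernel and cokernel results become available for every cut-off \<open>r > 0\<close>;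
  the theorem is the case \<open>r = 2\<close>.\<close>

lemma cokernel_setting:
  assumes r: "0 < r"
  shows "cokernel_setting T (Tq r) I (proj r) incl r"
proof -
  interpret S: sub_double_complex "A G K act" "A_gt G K act r"
    by (rule sub_double_complex_A_gt) simp
  have one: "\<one>\<^bsub>Ob T (p + q)\<^esub> q = (\<lambda>gs ks. 1)" for p q
    by (simp add: A.Tot_one one_A_gt)
  show ?thesis
  proof (intro cokernel_setting.intro cokernel_setting_axioms.intro)
    show "cochain_complex T" "cochain_complex (Tq r)" "cochain_complex I"
      by (rule A.cochain_complex_Tot S.Y.cochain_complex_Tot cochain_complex_inv)+
    show "0 < r" by (rule r)
    show "proj r k \<in> hom (Ob T k) (Ob (Tq r) k)"
      "proj r k ` carrier (Ob T k) = carrier (Ob (Tq r) k)" for k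
      by (rule S.Tot_proj_hom S.Tot_proj_surj)+
    show "proj r (Suc k) (df T k x) = df (Tq r) k (proj r k x)" if "x \<in> carrier (Ob T k)" for x k
      using that by (rule S.Tot_proj_df)
    show "incl k \<in> hom (Ob I k) (Ob T k)" "inj_on (incl k) (carrier (Ob I k))" if "0 < k" for k
      using that incl_hom incl_inj inj_on_subset by blast+
    show "incl (Suc k) (df I k y) = df T k (incl k y)" if "0 < k" "y \<in> carrier (Ob I k)" for k y
      using incl_df[OF that] by (simp add: df_inv_cplx)
    show "proj r k (incl k y) = \<one>\<^bsub>Ob (Tq r) k\<^esub>" if "r < k" "y \<in> carrier (Ob I k)" for k y
    proof -
      have "incl k y \<in> carrier (Ob T k)"
        using that by (auto simp: incl_closed carrier_inv_cplx)
      then show ?thesis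
        using that by (auto simp: S.Tot_proj_eq_one_iff incl_apply carrier_A_gt carrier_inv_cplx one_in_cochains)
    qed
    fix x
    assume x: "x \<in> carrier (Ob T (Suc r))" and px: "proj r (Suc r) x = \<one>\<^bsub>Ob (Tq r) (Suc r)\<^esub>"
      and dx: "df T (Suc r) x \<in> incl (Suc (Suc r)) ` carrier (Ob I (Suc (Suc r)))"
    \<comment> \<open>A trivial projection confines \<open>x\<close> to the rows above
      \<open>r\<close>; in total degree \<open>Suc r\<close> only the component in bidegree
      \<open>(0, Suc r)\<close> remains.\<close>
    have xS: "Suc r = p + q \<Longrightarrow> x q \<in> carrier (DOb (A_gt G K act r) p q)" for p q
      using px S.Tot_proj_eq_one_iff[OF x] by blast
    have xr: "x (Suc r) \<in> carrier (C 0 (Suc r))"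
      using xS[of 0 "Suc r"] by (simp add: carrier_A_gt)
    have x1: "x r = (\<lambda>gs ks. 1)"
      using xS[of 1 r] by (simp add: carrier_A_gt)
    \<comment> \<open>Images of \<open>incl\<close> are trivial in bidegree
      \<open>(1, Suc r)\<close>. There the differential of \<open>x\<close> is
      \<open>\<delta>G\<close> of its top component, as \<open>x r\<close> is trivial; hence that
      component is invariant.\<close>
    have "df T (Suc r) x (Suc r) = (\<lambda>gs ks. 1)"
      using dx incl_apply[of 1 "Suc r"] by auto
    then have "\<delta>G 0 (Suc r) (x (Suc r)) = (\<lambda>gs ks. 1)"
      using A.Tot_df_mid[of 0 r x] A.one_int_pow[of 1 "Suc r" "- 1"]
      by (simp add: x1 dh_A_gt dv_A_gt delta_K_one one_A_gt mult_A_gt)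
    then have "x (Suc r) \<in> carrier (Ob I (Suc r))"
      using xr by (simp add: carrier_inv_cplx)
    moreover have "x = incl (Suc r) (x (Suc r))"
    proof (rule A.Tot_eqI[OF x])
      show "incl (Suc r) (x (Suc r)) \<in> carrier (Ob T (Suc r))"
        using xr by (simp add: incl_closed)
      fix p q assume pq: "Suc r = p + q"
      show "x q = incl (Suc r) (x (Suc r)) q"
      proof (cases "p = 0")
        case False
        then have "x q = (\<lambda>gs ks. 1)"
          using xS[OF pq] pq by (simp add: carrier_A_gt split: if_splits)
        then show ?thesis
          using False pq by (simp add: incl_def)
      qed (use pq in \<open>simp add: incl_def\<close>)
    qed
    ultimately show "x \<in> incl (Suc r) ` carrier (Ob I (Suc r))"
      by blast
  qed
qed

section \<open>Total degree 3 and the identification of \<open>MS\<close>\<close>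

lemma triple_apply:
  "triple \<alpha> \<beta> \<theta> 0 = (\<lambda>gs ks. 1)" "triple \<alpha> \<beta> \<theta> 1 = \<alpha>" "triple \<alpha> \<beta> \<theta> 2 = \<beta>" "triple \<alpha> \<beta> \<theta> 3 = \<theta>"
  by (simp_all add: triple_def)

lemma degree_3_cases:
  assumes "3 = p + (q::nat)"
  obtains "p = 3" "q = 0" | "p = 2" "q = 1" | "p = 1" "q = 2" | "p = 0" "q = 3"
proof -
  have "q = 0 \<or> q = 1 \<or> q = 2 \<or> q = 3"
    using assms by arith
  then show thesis
    using assms that by auto
qed

lemma triple_mem_iff:
  "triple \<alpha> \<beta> \<theta> \<in> carrier (Ob T 3) \<longleftrightarrow>
    \<alpha> \<in> carrier (C 2 1) \<and> \<beta> \<in> carrier (C 1 2) \<and> \<theta> \<in> carrier (C 0 3)"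
proof
  assume *: "triple \<alpha> \<beta> \<theta> \<in> carrier (Ob T 3)"
  have "triple \<alpha> \<beta> \<theta> 1 \<in> carrier (DOb (A G K act) 2 1)" "triple \<alpha> \<beta> \<theta> 2 \<in> carrier (DOb (A G K act) 1 2)"
    "triple \<alpha> \<beta> \<theta> 3 \<in> carrier (DOb (A G K act) 0 3)"
    using A.Tot_mem[of "triple \<alpha> \<beta> \<theta>" 2 1] A.Tot_mem[of "triple \<alpha> \<beta> \<theta>" 1 2]
      A.Tot_mem[of "triple \<alpha> \<beta> \<theta>" 0 3] *
    by (simp_all add: numeral_3_eq_3)
  then show "\<alpha> \<in> carrier (C 2 1) \<and> \<beta> \<in> carrier (C 1 2) \<and> \<theta> \<in> carrier (C 0 3)"
    by (simp add: triple_def carrier_A_gt)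
next
  assume *: "\<alpha> \<in> carrier (C 2 1) \<and> \<beta> \<in> carrier (C 1 2) \<and> \<theta> \<in> carrier (C 0 3)"
  show "triple \<alpha> \<beta> \<theta> \<in> carrier (Ob T 3)"
  proof (rule A.Tot_memI)
    fix p q :: nat assume "3 = p + q"
    then show "triple \<alpha> \<beta> \<theta> q \<in> carrier (DOb (A G K act) p q)"
      by (cases rule: degree_3_cases) (use * in \<open>simp_all add: triple_def carrier_A_gt\<close>)
  qed (simp add: triple_def)
qed

text \<open>\<open>A\<close> is trivial in row 0, so \<open>x 0\<close> is the constant 1 built into
  \<open>triple\<close>.\<close>

lemma triple_cases:
  assumes x: "x \<in> carrier (Ob T 3)"
  obtains \<alpha> \<beta> \<theta> where "x = triple \<alpha> \<beta> \<theta>"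
    "\<alpha> \<in> carrier (C 2 1)" "\<beta> \<in> carrier (C 1 2)" "\<theta> \<in> carrier (C 0 3)"
proof -
  have mem: "x 0 \<in> carrier (DOb (A G K act) 3 0)" "x 1 \<in> carrier (DOb (A G K act) 2 1)"
    "x 2 \<in> carrier (DOb (A G K act) 1 2)" "x 3 \<in> carrier (DOb (A G K act) 0 3)"
    using A.Tot_mem[of x 3 0] A.Tot_mem[of x 2 1] A.Tot_mem[of x 1 2] A.Tot_mem[of x 0 3] x
    by (simp_all add: numeral_3_eq_3)
  then have C: "x 1 \<in> carrier (C 2 1)" "x 2 \<in> carrier (C 1 2)" "x 3 \<in> carrier (C 0 3)"
    and one: "x 0 = (\<lambda>gs ks. 1)"
    by (simp_all add: carrier_A_gt)
  have "x = triple (x 1) (x 2) (x 3)"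
  proof (rule A.Tot_eqI[OF x])
    show "triple (x 1) (x 2) (x 3) \<in> carrier (Ob T 3)"
      using C by (simp add: triple_mem_iff)
    fix p q :: nat assume "3 = p + q"
    then show "x q = triple (x 1) (x 2) (x 3) q"
      by (cases rule: degree_3_cases) (simp_all only: triple_apply one)
  qed
  then show thesis
    using C that by blast
qed

text \<open>\<theta> lies in the subgroup that is divided out, so its coset is that of 1.\<close>

lemma proj_triple:
  assumes "\<theta> \<in> carrier (C 0 3)"
  shows "proj 2 3 (triple \<alpha> \<beta> \<theta>) = pair G K act \<alpha> \<beta>"
  unfolding pair_def Tot_proj_def
proof (rule restrict_ext)
  fix q :: nat assume "q \<in> {..3}"
  interpret S: sub_double_complex "A G K act" "A_gt G K act 2"
    by (rule sub_double_complex_A_gt) simp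
  have "carrier (DOb (A_gt G K act 2) 0 3) #>\<^bsub>DOb (A G K act) 0 3\<^esub> \<psi> = carrier (DOb (A_gt G K act 2) 0 3)"
    if "\<psi> \<in> carrier (C 0 3)" for \<psi>
    by (rule group.coset_join2[OF A.group_DOb _ S.subgroup_S]) (use that in \<open>simp_all add: carrier_A_gt\<close>)
  then show "carrier (DOb (A_gt G K act 2) (3 - q) q) #>\<^bsub>DOb (A G K act) (3 - q) q\<^esub> triple \<alpha> \<beta> \<theta> q
      = carrier (DOb (A_gt G K act 2) (3 - q) q) #>\<^bsub>DOb (A G K act) (3 - q) q\<^esub> triple \<alpha> \<beta> (\<lambda>gs ks. 1) q"
    using assms one_in_cochains \<open>q \<in> {..3}\<close> by (cases "q = 3") (simp_all add: triple_def)
qed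

text \<open>In bidegree \<open>(1, 3)\<close> the sign is -1, so the component is the quotient of
  \<open>\<delta>G 0 3 \<theta>\<close> by \<open>\<delta>K 1 2 \<beta>\<close>.\<close>

lemma df_triple_3_eq_one_iff:
  assumes "\<beta> \<in> carrier (C 1 2)" "\<theta> \<in> carrier (C 0 3)"
  shows "df T 3 (triple \<alpha> \<beta> \<theta>) 3 = (\<lambda>gs ks. 1) \<longleftrightarrow> \<delta>K 1 2 \<beta> = \<delta>G 0 3 \<theta>"
proof -
  interpret D: group "DOb (A G K act) 1 3" by (rule A.group_DOb)
  have mem: "\<delta>G 0 3 \<theta> \<in> carrier (DOb (A G K act) 1 3)" "\<delta>K 1 2 \<beta> \<in> carrier (DOb (A G K act) 1 3)"
    using delta_G_closed[OF assms(2)] delta_K_closed[OF assms(1)] by (simp_all add: carrier_A_gt numeral_3_eq_3)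
  have df: "df T 3 (triple \<alpha> \<beta> \<theta>) 3
      = \<delta>G 0 3 \<theta> \<otimes>\<^bsub>DOb (A G K act) 1 3\<^esub> inv\<^bsub>DOb (A G K act) 1 3\<^esub> (\<delta>K 1 2 \<beta>)"
    using A.Tot_df_mid[of 0 2 "triple \<alpha> \<beta> \<theta>"] mem D.int_pow_neg[OF mem(2), of 1]
    by (simp add: triple_apply dh_A_gt dv_A_gt)
  have "\<one>\<^bsub>DOb (A G K act) 1 3\<^esub> = \<delta>G 0 3 \<theta> \<otimes>\<^bsub>DOb (A G K act) 1 3\<^esub> inv\<^bsub>DOb (A G K act) 1 3\<^esub> (\<delta>K 1 2 \<beta>)
      \<longleftrightarrow> \<delta>G 0 3 \<theta> = \<delta>K 1 2 \<beta>"
    using D.inv_solve_right[OF D.one_closed mem] D.l_one[OF mem(2)] by (simp only:)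
  then show ?thesis
    unfolding df one_A_gt by (simp only: eq_commute)
qed

text \<open>The defining conditions of \<open>MS\<close> are read off from the components of a
  differential: those in rows up to 2 give the cocycle condition in the quotient, the one in
  bidegree \<open>(1, 3)\<close> gives the condition on \<theta>, and invariance of the top one
  follows.\<close>

lemma MS_eq: "MS G K act = cokernel_setting.M T (Tq 2) I (proj 2) incl 2"
proof -
  interpret S: cokernel_setting T "Tq 2" I "proj 2" incl 2
    by (rule cokernel_setting) simp
  interpret Q: sub_double_complex "A G K act" "A_gt G K act 2"
    by (rule sub_double_complex_A_gt) simp
  have Z: "S.Z = {x \<in> carrier (Ob T 3). df T 3 x \<in> incl 4 ` carrier (Ob I 4)}"
    by (simp add: S.Z_def)
  have one: "y 3 = (\<lambda>gs ks. 1)" if "y \<in> incl 4 ` carrier (Ob I 4)" for y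
    using that by (auto simp: incl_def)
  have "{coh_class (Tq 2) 3 (pair G K act \<alpha> \<beta>) | \<alpha> \<beta>.
        \<alpha> \<in> carrier (C 2 1) \<and> \<beta> \<in> carrier (C 1 2) \<and> pair G K act \<alpha> \<beta> \<in> cocycles (Tq 2) 3 \<and>
        (\<exists>\<theta>\<in>carrier (C 0 3). \<delta>K 1 2 \<beta> = \<delta>G 0 3 \<theta>)}
      = (\<lambda>x. coh_class (Tq 2) 3 (proj 2 3 x)) ` S.Z" (is "?L = ?R")
  proof (intro equalityI subsetI)
    fix X assume "X \<in> ?R"
    then obtain x where x: "x \<in> S.Z" "X = coh_class (Tq 2) 3 (proj 2 3 x)"
      by blast
    then obtain \<alpha> \<beta> \<theta> where t: "x = triple \<alpha> \<beta> \<theta>"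
      and C: "\<alpha> \<in> carrier (C 2 1)" "\<beta> \<in> carrier (C 1 2)" "\<theta> \<in> carrier (C 0 3)"
      using triple_cases unfolding Z by blast
    have "pair G K act \<alpha> \<beta> \<in> cocycles (Tq 2) 3"
      using S.proj_cocycle[OF x(1)] C(3) by (simp add: t proj_triple)
    moreover have "\<delta>K 1 2 \<beta> = \<delta>G 0 3 \<theta>"
      using x(1) one df_triple_3_eq_one_iff[OF C(2,3)] by (auto simp: Z t)
    ultimately show "X \<in> ?L"
      using x(2) t C proj_triple by auto
  next
    fix X assume "X \<in> ?L"
    then obtain \<alpha> \<beta> \<theta> where X: "X = coh_class (Tq 2) 3 (pair G K act \<alpha> \<beta>)"
      and C: "\<alpha> \<in> carrier (C 2 1)" "\<beta> \<in> carrier (C 1 2)" "\<theta> \<in> carrier (C 0 3)"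
      and coc: "pair G K act \<alpha> \<beta> \<in> cocycles (Tq 2) 3" and eq: "\<delta>K 1 2 \<beta> = \<delta>G 0 3 \<theta>"
      by blast
    define x where "x = triple \<alpha> \<beta> \<theta>"
    have x: "x \<in> carrier (Ob T 3)"
      using C by (simp add: x_def triple_mem_iff)
    have px: "proj 2 3 x = pair G K act \<alpha> \<beta>"
      using C(3) by (simp add: x_def proj_triple)
    \<comment> \<open>The top component of the differential of \<open>x\<close>. It is invariant
      since \<open>\<delta>G\<close> of it equals \<open>\<delta>K\<close> applied twice to
      \<beta>.\<close>
    define y where "y = \<delta>K 0 3 \<theta>"
    have "\<delta>G 0 4 y = \<delta>K 1 3 (\<delta>K 1 2 \<beta>)"
      using delta_G_delta_K[of 0 3 \<theta>] eq by (simp add: y_def)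
    then have y: "y \<in> carrier (Ob I 4)"
      using delta_K_delta_K[OF C(2)] delta_K_closed[OF C(3)]
      by (simp add: carrier_inv_cplx y_def)
    have dx: "df T 3 x \<in> carrier (Ob T 4)"
      using A.Tot_df_closed[OF x] by simp
    have "proj 2 4 (df T 3 x) = \<one>\<^bsub>Ob (Tq 2) 4\<^esub>"
      using Q.Tot_proj_df[OF x] coc px by (simp add: cocycles_def kernel_def)
    then have dS: "4 = p + q \<Longrightarrow> df T 3 x q \<in> carrier (DOb (A_gt G K act 2) p q)" for p q
      using Q.Tot_proj_eq_one_iff[OF dx] by blast
    have "df T 3 x = incl 4 y"
    proof (rule A.Tot_eqI[OF dx])
      show "incl 4 y \<in> carrier (Ob T 4)"
        using y by (simp add: incl_closed carrier_inv_cplx)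
      fix p q :: nat assume pq: "4 = p + q"
      \<comment> \<open>The components are settled by the choice of \<open>y\<close>, by the
        equation for \<theta>, and by the cocycle condition in the quotient, respectively.\<close>
      then consider "p = 0" "q = 4" | "p = 1" "q = 3" | "0 < p" "q \<le> 2"
        by linarith
      then show "df T 3 x q = incl 4 y q"
      proof cases
        case 1
        then show ?thesis
          using A.Tot_df_top[OF x] by (simp add: x_def triple_apply dv_A_gt y_def incl_def)
      next
        case 2
        then show ?thesis
          using eq df_triple_3_eq_one_iff[OF C(2,3)] by (simp add: x_def incl_def)
      next
        case 3
        then show ?thesis
          using dS[OF pq] by (simp add: carrier_A_gt incl_def)
      qed
    qed
    then have "x \<in> S.Z"
      using x y by (simp add: Z)
    then show "X \<in> ?R"
      using X px by force
  qed
  then have "MS G K act = (cohomology (Tq 2) 3)\<lparr>carrier := (\<lambda>x. coh_class (Tq 2) 3 (proj 2 3 x)) ` S.Z\<rparr>"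
    unfolding MS_def by (rule arg_cong)
  then show ?thesis
    by (simp add: S.M_def)
qed

end

theorem theorem5p8:
  fixes G :: "('g, 'a) monoid_scheme" and K :: "('k, 'b) monoid_scheme"
    and act :: "'g \<Rightarrow> 'k \<Rightarrow> 'k"
  assumes "group G" and "monoid K" and "act \<in> hom G (AutoGroup K)"
  shows
    "let H3 = cohomology (Tot (A G K act)) 3;
         H4 = cohomology (Tot (A G K act)) 4;
         I3 = cohomology (inv_cplx G K act) 3;
         I4 = cohomology (inv_cplx G K act) 4;
         \<phi> = phi G K act
     in group_hom H3 (MS G K act) \<phi> \<and>
        (\<forall>\<alpha> \<beta> \<theta>. triple \<alpha> \<beta> \<theta> \<in> cocycles (Tot (A G K act)) 3 \<longrightarrow>
           \<phi> (coh_class (Tot (A G K act)) 3 (triple \<alpha> \<beta> \<theta>)) =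
           coh_class (Tot (A_mod G K act)) 3 (pair G K act \<alpha> \<beta>)) \<and>
        H3\<lparr>carrier := kernel H3 (MS G K act) \<phi>\<rparr>
          \<cong> H3\<lparr>carrier := iota G K act 3 ` carrier I3\<rparr> \<and>
        MS G K act Mod (\<phi> ` carrier H3)
          \<cong> I4\<lparr>carrier := kernel I4 H4 (iota G K act 4)\<rparr>"
proof -
  interpret equivariant_monoid G K act
    using assms by (simp add: equivariant_monoid_def equivariant_monoid_axioms_def)
  interpret S: cokernel_setting T "Tq 2" I "proj 2" incl 2
    by (rule cokernel_setting) simp
  have phi: "phi G K act = S.\<phi>"
    by (simp add: phi_def)
  have "phi G K act (coh_class T 3 (triple \<alpha> \<beta> \<theta>)) = coh_class (Tq 2) 3 (pair G K act \<alpha> \<beta>)"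
    if "triple \<alpha> \<beta> \<theta> \<in> cocycles T 3" for \<alpha> \<beta> \<theta>
  proof -
    \<comment> \<open>Membership of the triple makes \<theta> a cochain, which
      \<open>proj_triple\<close> requires.\<close>
    have mem: "triple \<alpha> \<beta> \<theta> \<in> carrier (Ob T 3)"
      using that by (rule S.D.cocycles_carrier)
    then have "\<theta> \<in> carrier (C 0 3)"
      by (simp add: triple_mem_iff)
    then show ?thesis
      using S.phi_coh_class[of "triple \<alpha> \<beta> \<theta>"] mem by (simp add: phi proj_triple)
  qed
  moreover have "group_hom (cohomology T 3) (MS G K act) (phi G K act)"
    using S.group_hom_phi by (simp add: phi MS_eq)
  \<comment> \<open>The two groups of the kernel statement have equal carriers, so they are the same
    group.\<close>
  moreover have "kernel (cohomology T 3) (MS G K act) (phi G K act) = iota G K act 3 ` carrier (cohomology I 3)"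
    using S.kernel_phi by (simp add: phi MS_eq iota_def)
  moreover have "MS G K act Mod (phi G K act ` carrier (cohomology T 3))
      \<cong> (cohomology I 4)\<lparr>carrier := kernel (cohomology I 4) (cohomology T 4) (iota G K act 4)\<rparr>"
    using S.cokernel_iso by (simp add: phi MS_eq iota_def)
  ultimately show ?thesis
    by (simp add: Let_def)
qed

end
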